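(* Let $I$ be an infinite set of positive integers and for $i \in I$ let $G_i$ be a finite group and $H_i \le G_i$ a subgroup, with $|G_i| \to \infty$. Assume $|H_i|$ is superpolylogarithmic: for every constant $c>0$, $|H_i| \ge (\log|G_i|)^{c}$ for all sufficiently large $i \in I$. Let $X_i$ be the set of right cosets of $H_i$ in $G_i$ and $r_i$ the number of orbits of $H_i$ on $X_i$. (a) If there is a constant $c_0>0$ such that the average subdegree satisfies $|X_i|/r_i \le (\log|G_i|)^{c_0}$ for all sufficiently large $i \in I$, then the family $(G_i,H_i)_{i\in I}$ is distinguishable. (b) In particular, if there is a constant $c_0>0$ such that $|H_i : H_i \cap gH_ig^{-1}| \le (\log|G_i|)^{c_0}$ for all $g \in G_i$ and all sufficiently large $i \in I$, then the family $(G_i,H_i)_{i\in I}$ is distinguishable.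
   Context: For a finite group $G$, let $\mathrm{Irr}(G)$ be its set of complex irreducible characters and $d_\chi=\chi(e)$. For $H \le G$ let $D_H = \frac{1}{|G|}\sum_{\chi \in \mathrm{Irr}(G)} d_\chi \big|\sum_{h \in H, h \neq e}\chi(h)\big|$ (the $L_1$ distance between the distributions $P_H(\chi)=\frac{d_\chi}{|G|}\sum_{h\in H}\chi(h)$ and $P_{\{e\}}$ on $\mathrm{Irr}(G)$ produced by weak quantum Fourier sampling). A family $(G_i,H_i)_{i \in I}$ with $H_i \le G_i$, $I$ an infinite set of positive integers and $|G_i| \to \infty$, is called distinguishable if there is a constant $c>0$ such that $D_{H_i} \ge (\log|G_i|)^{-c}$ for all sufficiently large $i \in I$, and indistinguishable otherwise. $G$ acts on the set $X = G/H$ of right cosets of $H$ by right multiplication; the suborbits are the orbits of $H$ on $X$, the subdegrees are their sizes, and the rank $r_X(G)$ is the number of suborbits, so the average subdegree is $|G:H|/r_X(G)$. *)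

theory Defs
  imports "HOL-Algebra.Coset" "Jordan_Normal_Form.Matrix" Complex_Main
begin

definition mat_tr :: "complex mat \<Rightarrow> complex" where
  "mat_tr A = (\<Sum>i<dim_row A. A $$ (i, i))"

definition is_rep :: "('a, 'b) monoid_scheme \<Rightarrow> nat \<Rightarrow> ('a \<Rightarrow> complex mat) \<Rightarrow> bool" where
  "is_rep G n \<rho> \<longleftrightarrow>
     (\<forall>g\<in>carrier G. \<rho> g \<in> carrier_mat n n) \<and>
     \<rho> \<one>\<^bsub>G\<^esub> = 1\<^sub>m n \<and>
     (\<forall>g\<in>carrier G. \<forall>h\<in>carrier G. \<rho> (g \<otimes>\<^bsub>G\<^esub> h) = \<rho> g * \<rho> h)"

definition invariant_subspace ::
  "('a, 'b) monoid_scheme \<Rightarrow> nat \<Rightarrow> ('a \<Rightarrow> complex mat) \<Rightarrow> complex vec set \<Rightarrow> bool" where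
  "invariant_subspace G n \<rho> W \<longleftrightarrow>
     W \<subseteq> carrier_vec n \<and> 0\<^sub>v n \<in> W \<and>
     (\<forall>v\<in>W. \<forall>w\<in>W. v + w \<in> W) \<and>
     (\<forall>c. \<forall>v\<in>W. c \<cdot>\<^sub>v v \<in> W) \<and>
     (\<forall>g\<in>carrier G. \<forall>v\<in>W. \<rho> g *\<^sub>v v \<in> W)"

definition irreducible_rep :: "('a, 'b) monoid_scheme \<Rightarrow> nat \<Rightarrow> ('a \<Rightarrow> complex mat) \<Rightarrow> bool" where
  "irreducible_rep G n \<rho> \<longleftrightarrow> is_rep G n \<rho> \<and> n > 0 \<and>
     (\<forall>W. invariant_subspace G n \<rho> W \<longrightarrow> W = {0\<^sub>v n} \<or> W = carrier_vec n)"

definition character :: "('a, 'b) monoid_scheme \<Rightarrow> ('a \<Rightarrow> complex mat) \<Rightarrow> 'a \<Rightarrow> complex" where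
  "character G \<rho> = (\<lambda>g. if g \<in> carrier G then mat_tr (\<rho> g) else 0)"

definition Irr :: "('a, 'b) monoid_scheme \<Rightarrow> ('a \<Rightarrow> complex) set" where
  "Irr G = {character G \<rho> | \<rho> n. irreducible_rep G n \<rho>}"

definition D_H :: "('a, 'b) monoid_scheme \<Rightarrow> 'a set \<Rightarrow> real" where
  "D_H G H = (1 / real (card (carrier G))) *
     (\<Sum>\<chi>\<in>Irr G. Re (\<chi> \<one>\<^bsub>G\<^esub>) * cmod (\<Sum>h\<in>H - {\<one>\<^bsub>G\<^esub>}. \<chi> h))"

definition suborbits :: "('a, 'b) monoid_scheme \<Rightarrow> 'a set \<Rightarrow> 'a set set set" where
  "suborbits G H = {{X #>\<^bsub>G\<^esub> h | h. h \<in> H} | X. X \<in> rcosets\<^bsub>G\<^esub> H}"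

definition rank_coset :: "('a, 'b) monoid_scheme \<Rightarrow> 'a set \<Rightarrow> nat" where
  "rank_coset G H = card (suborbits G H)"

definition eventually_in :: "nat set \<Rightarrow> (nat \<Rightarrow> bool) \<Rightarrow> bool" where
  "eventually_in I P \<longleftrightarrow> (\<exists>N. \<forall>i\<in>I. i \<ge> N \<longrightarrow> P i)"

definition distinguishable :: "nat set \<Rightarrow> (nat \<Rightarrow> ('a, 'b) monoid_scheme) \<Rightarrow> (nat \<Rightarrow> 'a set) \<Rightarrow> bool" where
  "distinguishable I G H \<longleftrightarrow>
     (\<exists>c>0. eventually_in I (\<lambda>i. D_H (G i) (H i) \<ge> ln (real (card (carrier (G i)))) powr (- c)))"

end

(* Put k = |H|, m = (1/k) * (sum of chi over H) and d = chi(1). Since m is the multiplicity of the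
   trivial character in the restriction of chi to H, it is a natural number with 0 <= m <= d, so that
     d |k m - d| >= m (k m - d) >= k m^2 / 2 - d^2 / (2 k).
   Summing over Irr G with sum d^2 = |G| and sum m^2 = rank (column orthogonality and Burnside's
   lemma) gives D_H >= k * rank / (2 |G|) - 1 / (2 k). If the average subdegree |G| / (k * rank) is
   at most L and k is superpolylogarithmic, this is at least 1 / (4 L). For (b), the sum of
   |H Int g H g^-1| over g is rank * k^2, so the average subdegree is at most the maximum of
   |H : H Int g H g^-1|.

   Unitarity and complete reducibility are not needed: psi(g^-1) replaces the conjugate of psi(g),
   and block triangular decompositions of representations
   suffice because they determine the traces. *)

theory Submission
  imports Defs "HOL-Algebra.Group_Action" "Jordan_Normal_Form.Spectral_Radius"
begin

section \<open>Schur's lemma and row orthogonality\<close>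

text \<open>Trading the weight d for the smaller m makes the leading term k m^2, whose total is a
  multiple of the rank. The negative cross term m d is absorbed by completing a square, which costs
  half of the leading term and a multiple of d^2. The latter totals |G|, so only 1/(2k) is lost, and
  this loss is what a superpolylogarithmic |H| makes negligible.

  The obstacle is column orthogonality: it requires that the irreducible characters span the class
  functions, and even the finiteness of \<open>Irr G\<close> has to be proved. Both come from the
  regular representation. Its trace splits into a list of irreducible characters, and a class
  function acts on each constituent by a scalar. Expanding an irreducible character at the identity
  then shows that it occurs in the list as often as its degree. Hence lists come before sets: the
  list bounds \<open>Irr G\<close>, and counting entries converts sums over the list into sums over
  \<open>Irr G\<close>.\<close>

lemma mat_tr_mult_comm:
  assumes "A \<in> carrier_mat n m" "B \<in> carrier_mat m n"
  shows "mat_tr (A * B) = mat_tr (B * A)"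
proof -
  have "mat_tr (A * B) = (\<Sum>i<n. \<Sum>k<m. A $$ (i,k) * B $$ (k,i))"
    using assms by (auto simp: mat_tr_def scalar_prod_def lessThan_atLeast0 intro!: sum.cong)
  also have "\<dots> = (\<Sum>k<m. \<Sum>i<n. B $$ (k,i) * A $$ (i,k))"
    by (subst sum.swap) (simp add: mult.commute)
  also have "\<dots> = mat_tr (B * A)"
    using assms by (auto simp: mat_tr_def scalar_prod_def lessThan_atLeast0 intro!: sum.cong)
  finally show ?thesis .
qed

lemma mat_tr_one [simp]: "mat_tr (1\<^sub>m n) = of_nat n"
  by (simp add: mat_tr_def)

lemma mat_mult_entry:
  assumes "A \<in> carrier_mat n m" "B \<in> carrier_mat m k" "i < n" "j < k"
  shows "(A * B) $$ (i, j) = (\<Sum>l<m. A $$ (i, l) * B $$ (l, j))"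
  using assms by (auto simp: scalar_prod_def lessThan_atLeast0 intro!: sum.cong)

lemma mult_unit_vec_eq_col:
  fixes A :: "'a::semiring_1 mat"
  assumes "A \<in> carrier_mat n m" "j < m"
  shows "A *\<^sub>v unit_vec m j = col A j"
  by (rule eq_vecI) (use assms in auto)

lemma mult_vec_zero_imp_zero_mat:
  fixes A :: "'a::semiring_1 mat"
  assumes A: "A \<in> carrier_mat n m" and "\<And>v. v \<in> carrier_vec m \<Longrightarrow> A *\<^sub>v v = 0\<^sub>v n"
  shows "A = 0\<^sub>m n m"
proof (rule eq_matI)
  fix i j assume ij: "i < dim_row (0\<^sub>m n m)" "j < dim_col (0\<^sub>m n m)"
  have "A *\<^sub>v unit_vec m j = col A j"
    using A ij by (intro mult_unit_vec_eq_col) auto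
  hence "col A j = 0\<^sub>v n" using assms(2)[of "unit_vec m j"] by simp
  moreover have "A $$ (i, j) = col A j $ i" using A ij by simp
  ultimately show "A $$ (i, j) = 0\<^sub>m n m $$ (i, j)" using ij by simp
qed (use A in auto)

lemma is_repD:
  assumes "is_rep G n \<rho>"
  shows "g \<in> carrier G \<Longrightarrow> \<rho> g \<in> carrier_mat n n"
    and "\<rho> \<one>\<^bsub>G\<^esub> = 1\<^sub>m n"
    and "g \<in> carrier G \<Longrightarrow> h \<in> carrier G \<Longrightarrow> \<rho> (g \<otimes>\<^bsub>G\<^esub> h) = \<rho> g * \<rho> h"
  using assms by (auto simp: is_rep_def)

lemma is_rep_mult_entry:
  assumes "is_rep G n \<rho>" "g \<in> carrier G" "h \<in> carrier G" "i < n" "j < n"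
  shows "\<rho> (g \<otimes>\<^bsub>G\<^esub> h) $$ (i, j) = (\<Sum>l<n. \<rho> g $$ (i, l) * \<rho> h $$ (l, j))"
  using assms by (simp add: is_repD mat_mult_entry[of _ n n _ n])

lemma irreducible_repD:
  assumes "irreducible_rep G n \<rho>"
  shows "is_rep G n \<rho>" "n > 0"
    "invariant_subspace G n \<rho> W \<Longrightarrow> W = {0\<^sub>v n} \<or> W = carrier_vec n"
  using assms by (auto simp: irreducible_rep_def)

lemma (in group) character_one:
  assumes "is_rep G n \<rho>" shows "character G \<rho> \<one> = of_nat n"
  using assms by (simp add: character_def is_repD)

text \<open>The kernel and the image of an intertwiner are invariant subspaces. Since T is nonzero,
  the kernel is proper and the image is not zero, so irreducibility makes T injective and
  surjective.\<close>

lemma schur_inverse: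
  assumes \<rho>: "irreducible_rep G n \<rho>" and \<sigma>: "irreducible_rep G m \<sigma>"
    and T: "T \<in> carrier_mat n m" and comm: "\<And>g. g \<in> carrier G \<Longrightarrow> \<rho> g * T = T * \<sigma> g"
    and nz: "T \<noteq> 0\<^sub>m n m"
  obtains S where "S \<in> carrier_mat m n" "T * S = 1\<^sub>m n" "S * T = 1\<^sub>m m"
proof -
  note r = irreducible_repD(1)[OF \<rho>] and s = irreducible_repD(1)[OF \<sigma>]
  define K where "K = {v \<in> carrier_vec m. T *\<^sub>v v = 0\<^sub>v n}"
  have comm': "\<rho> g *\<^sub>v (T *\<^sub>v v) = T *\<^sub>v (\<sigma> g *\<^sub>v v)" if "g \<in> carrier G" "v \<in> carrier_vec m" for g v
    using comm[OF that(1)] that T is_repD(1)[OF r that(1)] is_repD(1)[OF s that(1)]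
    by (metis assoc_mult_mat_vec)
  have "invariant_subspace G m \<sigma> K"
    unfolding invariant_subspace_def
  proof (intro conjI ballI allI)
    show "0\<^sub>v m \<in> K" using T by (auto simp: K_def)
    fix v w assume "v \<in> K" "w \<in> K"
    thus "v + w \<in> K" using T by (auto simp: K_def mult_add_distrib_mat_vec)
  next
    fix c v assume "v \<in> K"
    thus "c \<cdot>\<^sub>v v \<in> K" using T by (auto simp: K_def mult_mat_vec)
  next
    fix g v assume g: "g \<in> carrier G" and "v \<in> K"
    moreover have "\<rho> g *\<^sub>v 0\<^sub>v n = 0\<^sub>v n" using is_repD(1)[OF r g] by auto
    ultimately show "\<sigma> g *\<^sub>v v \<in> K"
      using comm'[OF g, of v] mult_mat_vec_carrier[OF is_repD(1)[OF s g], of v] by (simp add: K_def)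
  qed (auto simp: K_def)
  moreover have "K \<noteq> carrier_vec m"
    using mult_vec_zero_imp_zero_mat[OF T] nz by (auto simp: K_def)
  ultimately have K0: "K = {0\<^sub>v m}" using irreducible_repD(3)[OF \<sigma>] by blast
  define R where "R = {T *\<^sub>v v | v. v \<in> carrier_vec m}"
  have "invariant_subspace G n \<rho> R"
    unfolding invariant_subspace_def
  proof (intro conjI ballI allI)
    show "R \<subseteq> carrier_vec n" using T by (auto simp: R_def)
    have "T *\<^sub>v 0\<^sub>v m = 0\<^sub>v n" using T by auto
    thus "0\<^sub>v n \<in> R" unfolding R_def by (metis (mono_tags, lifting) mem_Collect_eq zero_carrier_vec)
    fix v w assume "v \<in> R" "w \<in> R"
    then obtain a b where "v = T *\<^sub>v a" "w = T *\<^sub>v b" "a \<in> carrier_vec m" "b \<in> carrier_vec m"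
      by (auto simp: R_def)
    thus "v + w \<in> R" unfolding R_def
      using T by (auto intro!: exI[of _ "a + b"] simp: mult_add_distrib_mat_vec)
  next
    fix c v assume "v \<in> R"
    then obtain a where "v = T *\<^sub>v a" "a \<in> carrier_vec m" by (auto simp: R_def)
    thus "c \<cdot>\<^sub>v v \<in> R" unfolding R_def
      using T by (auto intro!: exI[of _ "c \<cdot>\<^sub>v a"] simp: mult_mat_vec)
  next
    fix g v assume g: "g \<in> carrier G" and "v \<in> R"
    then obtain a where a: "v = T *\<^sub>v a" "a \<in> carrier_vec m" by (auto simp: R_def)
    have "\<sigma> g *\<^sub>v a \<in> carrier_vec m" using is_repD(1)[OF s g] a by auto
    thus "\<rho> g *\<^sub>v v \<in> R" using comm'[OF g a(2)] a by (auto simp: R_def)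
  qed
  moreover have "R \<noteq> {0\<^sub>v n}"
    using mult_vec_zero_imp_zero_mat[OF T] nz by (auto simp: R_def)
  ultimately have R: "R = carrier_vec n" using irreducible_repD(3)[OF \<rho>] by blast
  \<comment> \<open>Surjectivity gives a preimage of each unit vector; with these as columns, S is a
    right inverse of T.\<close>
  have "\<forall>j. \<exists>v. v \<in> carrier_vec m \<and> T *\<^sub>v v = unit_vec n j"
  proof
    fix j
    have "unit_vec n j \<in> R" using R by simp
    thus "\<exists>v. v \<in> carrier_vec m \<and> T *\<^sub>v v = unit_vec n j" by (auto simp: R_def)
  qed
  then obtain f where f: "\<And>j. f j \<in> carrier_vec m" "\<And>j. T *\<^sub>v f j = unit_vec n j" by metis
  define S where "S = mat_of_cols m (map f [0..<n])"
  have S: "S \<in> carrier_mat m n" by (auto simp: S_def)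
  have colS: "col S j = f j" if "j < n" for j
    using that f by (simp add: S_def)
  have TS: "T * S = 1\<^sub>m n"
  proof (rule mat_col_eqI)
    fix j assume "j < dim_col (1\<^sub>m n)"
    hence "col (T * S) j = T *\<^sub>v col S j" using T S by (intro col_mult2) auto
    thus "col (T * S) j = col (1\<^sub>m n) j" using colS f \<open>j < dim_col (1\<^sub>m n)\<close> by simp
  qed (use T S in auto)
  \<comment> \<open>T sends S(Tv) - v to (TS)(Tv) - Tv = 0, so this vector lies in the trivial
    kernel. The left inverse is thus obtained without comparing n and m.\<close>
  have "S * T - 1\<^sub>m m = 0\<^sub>m m m"
  proof (rule mult_vec_zero_imp_zero_mat)
    show "S * T - 1\<^sub>m m \<in> carrier_mat m m" using S T by auto
    fix v :: "complex vec" assume v: "v \<in> carrier_vec m"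
    have e: "(S * T - 1\<^sub>m m) *\<^sub>v v = S *\<^sub>v (T *\<^sub>v v) - v"
      using S T v by (subst minus_mult_distrib_mat_vec[of _ m m]) auto
    have "T *\<^sub>v (S *\<^sub>v (T *\<^sub>v v) - v) = T *\<^sub>v (S *\<^sub>v (T *\<^sub>v v)) - T *\<^sub>v v"
      using S T v by (intro mult_minus_distrib_mat_vec) auto
    also have "T *\<^sub>v (S *\<^sub>v (T *\<^sub>v v)) = (T * S) *\<^sub>v (T *\<^sub>v v)"
      using S T v by (intro assoc_mult_mat_vec[symmetric]) auto
    also have "\<dots> = T *\<^sub>v v" unfolding TS using T v by (intro one_mult_mat_vec) auto
    finally have "S *\<^sub>v (T *\<^sub>v v) - v \<in> K" unfolding K_def using S T v by auto
    thus "(S * T - 1\<^sub>m m) *\<^sub>v v = 0\<^sub>v m" using K0 e by auto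
  qed
  have "S * T = 1\<^sub>m m"
  proof (rule eq_matI)
    fix i j assume "i < dim_row (1\<^sub>m m)" "j < dim_col (1\<^sub>m m)"
    thus "(S * T) $$ (i, j) = 1\<^sub>m m $$ (i, j)"
      using arg_cong[OF \<open>S * T - 1\<^sub>m m = 0\<^sub>m m m\<close>, of "\<lambda>A. A $$ (i, j)"] S T by simp
  qed (use S T in auto)
  with S TS that show thesis by blast
qed

text \<open>Over the complex numbers T has an eigenvalue as soon as n > 0. Its eigenspace is
  invariant and nonzero, hence the whole space. The conclusion is phrased by entries because the
  later uses are sums of entries.\<close>

lemma schur_scalar:
  assumes \<rho>: "irreducible_rep G n \<rho>"
    and T: "T \<in> carrier_mat n n" and comm: "\<And>g. g \<in> carrier G \<Longrightarrow> \<rho> g * T = T * \<rho> g"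
  obtains c where "\<And>i j. i < n \<Longrightarrow> j < n \<Longrightarrow> T $$ (i, j) = (if i = j then c else 0)"
proof -
  note r = irreducible_repD(1)[OF \<rho>]
  obtain c where "c \<in> spectrum T"
    using spectrum_non_empty[OF T irreducible_repD(2)[OF \<rho>]] by auto
  then obtain v where "eigenvector T v c" by (auto simp: spectrum_def eigenvalue_def)
  hence v: "v \<in> carrier_vec n" "v \<noteq> 0\<^sub>v n" "T *\<^sub>v v = c \<cdot>\<^sub>v v"
    using T by (auto simp: eigenvector_def)
  define W where "W = {v \<in> carrier_vec n. T *\<^sub>v v = c \<cdot>\<^sub>v v}"
  have "invariant_subspace G n \<rho> W"
    unfolding invariant_subspace_def
  proof (intro conjI ballI allI)
    show "0\<^sub>v n \<in> W" using T by (auto simp: W_def)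
    fix v w assume "v \<in> W" "w \<in> W"
    thus "v + w \<in> W" using T by (auto simp: W_def mult_add_distrib_mat_vec smult_add_distrib_vec)
  next
    fix d v assume "v \<in> W"
    thus "d \<cdot>\<^sub>v v \<in> W" using T by (auto simp: W_def mult_mat_vec smult_smult_assoc mult.commute)
  next
    fix g v assume g: "g \<in> carrier G" and v: "v \<in> W"
    have "T *\<^sub>v (\<rho> g *\<^sub>v v) = \<rho> g *\<^sub>v (T *\<^sub>v v)"
      using comm[OF g] T is_repD(1)[OF r g] v unfolding W_def
      by (metis (no_types, lifting) assoc_mult_mat_vec mem_Collect_eq)
    also have "\<dots> = c \<cdot>\<^sub>v (\<rho> g *\<^sub>v v)"
      using v is_repD(1)[OF r g] by (auto simp: W_def mult_mat_vec)
    finally show "\<rho> g *\<^sub>v v \<in> W" using v is_repD(1)[OF r g] by (auto simp: W_def)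
  qed (auto simp: W_def)
  moreover have "W \<noteq> {0\<^sub>v n}" using v by (auto simp: W_def)
  ultimately have W: "W = carrier_vec n" using irreducible_repD(3)[OF \<rho>] by blast
  have "T $$ (i, j) = (if i = j then c else 0)" if ij: "i < n" "j < n" for i j
  proof -
    have "unit_vec n j \<in> W" using W by simp
    hence "col T j = c \<cdot>\<^sub>v unit_vec n j"
      unfolding W_def using mult_unit_vec_eq_col[OF T ij(2)] by simp
    moreover have "T $$ (i, j) = col T j $ i" using T ij by simp
    ultimately show ?thesis using ij by simp
  qed
  thus thesis by (rule that)
qed

text \<open>Entrywise form of the sum over g of \<open>\<rho> g * E * \<sigma> (inv g)\<close>, with E the matrix unit at position (a, b).\<close>

definition (in group) avg_mat where
  "avg_mat n m \<rho> \<sigma> a b =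
     mat n m (\<lambda>(i, j). \<Sum>g\<in>carrier G. (\<rho> g $$ (i, a) * \<sigma> (inv g) $$ (b, j) :: complex))"

text \<open>Averaging over the group turns any matrix, here a matrix unit, into an intertwiner:
  multiplication by h is absorbed by shifting the summation variable.\<close>

lemma (in group) avg_mat_intertwines:
  assumes r: "is_rep G n \<rho>" and s: "is_rep G m \<sigma>" and h: "h \<in> carrier G" and ab: "a < n" "b < m"
  shows "\<rho> h * avg_mat n m \<rho> \<sigma> a b = avg_mat n m \<rho> \<sigma> a b * \<sigma> h"
proof (rule eq_matI)
  note rc = is_repD(1)[OF r] and sc = is_repD(1)[OF s]
  let ?T = "avg_mat n m \<rho> \<sigma> a b"
  have T: "?T \<in> carrier_mat n m" by (simp add: avg_mat_def)
  fix i j assume "i < dim_row (?T * \<sigma> h)" "j < dim_col (?T * \<sigma> h)"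
  hence ij: "i < n" "j < m" using T sc[OF h] by auto
  have "(\<rho> h * ?T) $$ (i, j) =
      (\<Sum>l<n. \<rho> h $$ (i, l) * (\<Sum>g\<in>carrier G. \<rho> g $$ (l, a) * \<sigma> (inv g) $$ (b, j)))"
    using ij T rc[OF h] by (subst mat_mult_entry[of _ n n _ m]) (auto simp: avg_mat_def)
  also have "\<dots> = (\<Sum>g\<in>carrier G. (\<Sum>l<n. \<rho> h $$ (i, l) * \<rho> g $$ (l, a)) * \<sigma> (inv g) $$ (b, j))"
    by (subst sum_distrib_left, subst sum.swap) (simp add: sum_distrib_right mult.assoc)
  also have "\<dots> = (\<Sum>g\<in>carrier G. \<rho> (h \<otimes> g) $$ (i, a) * \<sigma> (inv g) $$ (b, j))"
    using ij ab h by (intro sum.cong) (simp_all add: is_rep_mult_entry[OF r])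
  \<comment> \<open>Substituting g for h g moves h to the other factor, because the inverse of (inv
    h) g is (inv g) h.\<close>
  also have "\<dots> = (\<Sum>g\<in>carrier G. \<rho> g $$ (i, a) * \<sigma> (inv g \<otimes> h) $$ (b, j))"
    by (rule sum.reindex_bij_witness[of _ "\<lambda>g. inv h \<otimes> g" "\<lambda>g. h \<otimes> g"])
       (use h in \<open>auto simp: m_assoc[symmetric] inv_mult_group\<close>,
        use h in \<open>auto simp: m_assoc\<close>)
  also have "\<dots> = (\<Sum>g\<in>carrier G. \<rho> g $$ (i, a) * (\<Sum>l<m. \<sigma> (inv g) $$ (b, l) * \<sigma> h $$ (l, j)))"
    using ij ab h by (intro sum.cong) (simp_all add: is_rep_mult_entry[OF s])
  also have "\<dots> = (\<Sum>l<m. (\<Sum>g\<in>carrier G. \<rho> g $$ (i, a) * \<sigma> (inv g) $$ (b, l)) * \<sigma> h $$ (l, j))"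
    by (subst sum_distrib_left, subst sum.swap) (simp add: sum_distrib_right mult.assoc)
  also have "\<dots> = (?T * \<sigma> h) $$ (i, j)"
    using ij T sc[OF h] by (subst mat_mult_entry[of _ n m _ m]) (auto simp: avg_mat_def)
  finally show "(\<rho> h * ?T) $$ (i, j) = (?T * \<sigma> h) $$ (i, j)" .
qed (use is_repD(1)[OF r h] is_repD(1)[OF s h] in \<open>auto simp: avg_mat_def\<close>)

text \<open>A product of two traces is a double sum of products of diagonal entries. This reduces
  the orthogonality relations to what Schur's lemma says about each \<open>avg_mat\<close>.\<close>

lemma (in group) character_pairing_avg_mat:
  assumes r: "is_rep G n \<rho>" and s: "is_rep G m \<sigma>"
  shows "(\<Sum>g\<in>carrier G. character G \<rho> g * character G \<sigma> (inv g))
    = (\<Sum>a<n. \<Sum>b<m. avg_mat n m \<rho> \<sigma> a b $$ (a, b))"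
proof -
  have "character G \<rho> g * character G \<sigma> (inv g) = (\<Sum>a<n. \<Sum>b<m. \<rho> g $$ (a, a) * \<sigma> (inv g) $$ (b, b))"
    if "g \<in> carrier G" for g
  proof -
    have "dim_row (\<rho> g) = n" "dim_row (\<sigma> (inv g)) = m"
      using that is_repD(1)[OF r, of g] is_repD(1)[OF s, of "inv g"] by auto
    thus ?thesis using that by (simp add: character_def mat_tr_def sum_product)
  qed
  hence "(\<Sum>g\<in>carrier G. character G \<rho> g * character G \<sigma> (inv g))
     = (\<Sum>g\<in>carrier G. \<Sum>a<n. \<Sum>b<m. \<rho> g $$ (a, a) * \<sigma> (inv g) $$ (b, b))"
    by (intro sum.cong) auto
  also have "\<dots> = (\<Sum>a<n. \<Sum>b<m. \<Sum>g\<in>carrier G. \<rho> g $$ (a, a) * \<sigma> (inv g) $$ (b, b))"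
    by (subst sum.swap, intro sum.cong refl, subst sum.swap) simp
  also have "\<dots> = (\<Sum>a<n. \<Sum>b<m. avg_mat n m \<rho> \<sigma> a b $$ (a, b))"
    by (intro sum.cong) (auto simp: avg_mat_def)
  finally show ?thesis .
qed

text \<open>A nonzero averaged matrix would be an invertible intertwiner, and similar matrices have
  equal traces, so the characters would coincide. Hence every averaged matrix vanishes.\<close>

lemma (in group) character_orthogonal:
  assumes \<rho>: "irreducible_rep G n \<rho>" and \<sigma>: "irreducible_rep G m \<sigma>"
    and ne: "character G \<rho> \<noteq> character G \<sigma>"
  shows "(\<Sum>g\<in>carrier G. character G \<rho> g * character G \<sigma> (inv g)) = 0"
proof -
  note r = irreducible_repD(1)[OF \<rho>] and s = irreducible_repD(1)[OF \<sigma>]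
  have "avg_mat n m \<rho> \<sigma> a b = 0\<^sub>m n m" if ab: "a < n" "b < m" for a b
  proof (rule ccontr)
    let ?T = "avg_mat n m \<rho> \<sigma> a b"
    assume nz: "?T \<noteq> 0\<^sub>m n m"
    have T: "?T \<in> carrier_mat n m" by (simp add: avg_mat_def)
    obtain S where S: "S \<in> carrier_mat m n" "?T * S = 1\<^sub>m n" "S * ?T = 1\<^sub>m m"
      using schur_inverse[OF \<rho> \<sigma> T avg_mat_intertwines[OF r s _ ab] nz] by blast
    have "mat_tr (\<rho> g) = mat_tr (\<sigma> g)" if g: "g \<in> carrier G" for g
    proof -
      note c = is_repD(1)[OF r g] is_repD(1)[OF s g]
      have "\<rho> g = \<rho> g * (?T * S)" using S c by simp
      also have "\<dots> = (\<rho> g * ?T) * S" using assoc_mult_mat[OF c(1) T S(1)] by simp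
      also have "\<dots> = (?T * \<sigma> g) * S" using avg_mat_intertwines[OF r s g ab] by simp
      finally have "mat_tr (\<rho> g) = mat_tr (S * (?T * \<sigma> g))"
        using mat_tr_mult_comm[of "?T * \<sigma> g" n m S] T S c by simp
      also have "S * (?T * \<sigma> g) = S * ?T * \<sigma> g" using assoc_mult_mat[OF S(1) T c(2)] by simp
      also have "\<dots> = \<sigma> g" using S c by simp
      finally show ?thesis .
    qed
    hence "character G \<rho> = character G \<sigma>" by (auto simp: character_def)
    with ne show False by simp
  qed
  thus ?thesis unfolding character_pairing_avg_mat[OF r s] by (intro sum.neutral ballI) simp
qed

text \<open>Each averaged matrix is a scalar matrix, and its trace determines the scalar: |G|/n for
  a = b and 0 otherwise. The n diagonal pairs add up to |G|.\<close>

lemma (in group) character_norm: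
  assumes \<rho>: "irreducible_rep G n \<rho>"
  shows "(\<Sum>g\<in>carrier G. character G \<rho> g * character G \<rho> (inv g)) = of_nat (card (carrier G))"
proof -
  note r = irreducible_repD(1)[OF \<rho>]
  have n: "n > 0" using \<rho> by (rule irreducible_repD)
  have diag: "avg_mat n n \<rho> \<rho> a b $$ (a, b) = (if a = b then of_nat (card (carrier G)) / of_nat n else 0)"
    if ab: "a < n" "b < n" for a b
  proof -
    let ?T = "avg_mat n n \<rho> \<rho> a b"
    have T: "?T \<in> carrier_mat n n" by (simp add: avg_mat_def)
    obtain c where l: "\<And>i j. i < n \<Longrightarrow> j < n \<Longrightarrow> ?T $$ (i, j) = (if i = j then c else 0)"
      using schur_scalar[OF \<rho> T avg_mat_intertwines[OF r r _ ab]] by blast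
    \<comment> \<open>In the trace the two factors combine into the (b, a) entry of \<rho> at (inv
      g) g, the identity, once for every g.\<close>
    have "of_nat n * c = (\<Sum>i<n. ?T $$ (i, i))" using l by simp
    also have "\<dots> = (\<Sum>i<n. \<Sum>g\<in>carrier G. \<rho> (inv g) $$ (b, i) * \<rho> g $$ (i, a))"
      by (intro sum.cong) (auto simp: avg_mat_def mult.commute)
    also have "\<dots> = (\<Sum>g\<in>carrier G. \<rho> (inv g \<otimes> g) $$ (b, a))"
      by (subst sum.swap, rule sum.cong[OF refl], rule is_rep_mult_entry[OF r, symmetric]) (use ab in auto)
    also have "\<dots> = (if a = b then of_nat (card (carrier G)) else 0)"
      using ab by (auto simp: is_repD(2)[OF r])
    finally show ?thesis using l[OF ab] n by (auto simp: field_simps)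
  qed
  have "(\<Sum>a<n. \<Sum>b<n. avg_mat n n \<rho> \<rho> a b $$ (a, b)) =
      (\<Sum>a<n. \<Sum>b<n. (if a = b then of_nat (card (carrier G)) / of_nat n else 0))"
    using diag by (intro sum.cong refl) auto
  also have "\<dots> = of_nat (card (carrier G))" using n by simp
  finally show ?thesis unfolding character_pairing_avg_mat[OF r r] .
qed

section \<open>Traces of representations as sums of irreducible characters\<close>

lemma (in vec_space) mat_inverse_from_span:
  assumes us: "set us \<subseteq> carrier_vec n" "length us = n"
    and span: "span (set us) = carrier_vec n"
  obtains Q where "Q \<in> carrier_mat n n" "mat_of_cols n us * Q = 1\<^sub>m n" "Q * mat_of_cols n us = 1\<^sub>m n"
proof -
  define P where "P = mat_of_cols n us"
  have P: "P \<in> carrier_mat n n" by (auto simp: P_def us)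
  have dim: "\<forall>w\<in>set us. dim_vec w = n" using us(1) by (metis carrier_vecD subsetD)
  have "\<exists>c. unit_vec n j = P *\<^sub>v vec n c" for j
  proof -
    have "unit_vec n j \<in> span_list us" using span span_list_as_span[OF us(1)] by simp
    then obtain c where "unit_vec n j = lincomb_list c us" by (auto simp: span_list_def)
    also have "\<dots> = P *\<^sub>v vec n c"
      using lincomb_list_as_mat_mult[OF dim, of c] us(2) by (simp add: P_def)
    finally show ?thesis by blast
  qed
  then obtain f where f: "\<And>j. unit_vec n j = P *\<^sub>v vec n (f j)" by metis
  define Q where "Q = mat_of_cols n (map (\<lambda>j. vec n (f j)) [0..<n])"
  have Q: "Q \<in> carrier_mat n n" by (auto simp: Q_def)
  have PQ: "P * Q = 1\<^sub>m n"
  proof (rule mat_col_eqI)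
    fix j assume "j < dim_col (1\<^sub>m n)"
    hence j: "j < n" by simp
    hence "col (P * Q) j = P *\<^sub>v col Q j" using P Q by (intro col_mult2) auto
    also have "col Q j = vec n (f j)" using j by (simp add: Q_def)
    finally show "col (P * Q) j = col (1\<^sub>m n) j" using f[of j] j by simp
  qed (use P Q in auto)
  hence "Q * P = 1\<^sub>m n" using mat_mult_left_right_inverse[OF P Q] by simp
  with PQ Q show thesis by (intro that) (auto simp: P_def)
qed

text \<open>A maximal independent set B in W is extended to a basis of the whole space. With B
  listed at the front, the leading k columns of P lie in W, and Q, which computes coordinates in
  this basis, kills the positions from k on for vectors of W.\<close>

lemma (in vec_space) adapted_basis:
  fixes W :: "'a vec set"
  assumes W: "W \<subseteq> carrier_vec n" "0\<^sub>v n \<in> W"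
    and add: "\<And>v w. v \<in> W \<Longrightarrow> w \<in> W \<Longrightarrow> v + w \<in> W"
    and smult: "\<And>c v. v \<in> W \<Longrightarrow> c \<cdot>\<^sub>v v \<in> W"
    and nontriv: "W \<noteq> {0\<^sub>v n}" "W \<noteq> carrier_vec n"
  obtains k P Q where "0 < k" "k < n" "P \<in> carrier_mat n n" "Q \<in> carrier_mat n n"
    "P * Q = 1\<^sub>m n" "Q * P = 1\<^sub>m n"
    "\<And>j. j < k \<Longrightarrow> col P j \<in> W"
    "\<And>w i. w \<in> W \<Longrightarrow> k \<le> i \<Longrightarrow> i < n \<Longrightarrow> (Q *\<^sub>v w) $ i = 0"
proof -
  have bound: "finite A \<and> card A \<le> n" if "A \<subseteq> carrier_vec n" "lin_indpt A" for A
    using li_le_dim[of A] that dim_is_n by auto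
  have "lin_indpt {}" by (auto simp: lin_dep_def)
  hence "\<exists>B. finite B \<and> maximal B (\<lambda>S. S \<subseteq> W \<and> lin_indpt S)"
    using W bound by (intro maximal_exists[of _ n "{}"]) auto
  then obtain B where B: "finite B" "B \<subseteq> W" "lin_indpt B"
    and Bmax: "\<And>S. B \<subseteq> S \<Longrightarrow> S \<subseteq> W \<Longrightarrow> lin_indpt S \<Longrightarrow> S = B"
    by (auto simp: maximal_def)
  have Bc: "B \<subseteq> carrier_vec n" using B W by auto
  have WB: "w \<in> span B" if w: "w \<in> W" for w
  proof (cases "w \<in> B")
    case True thus ?thesis using Bc in_own_span by auto
  next
    case False
    have "B \<union> {w} \<noteq> B" using False by auto
    hence "lin_dep (B \<union> {w})" using Bmax[of "B \<union> {w}"] w B by auto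
    thus ?thesis using lin_dep_iff_in_span[of B w] Bc B w W False by auto
  qed
  have "\<exists>A. finite A \<and> maximal A (\<lambda>S. S \<subseteq> carrier_vec n \<and> lin_indpt S \<and> B \<subseteq> S)"
    using B Bc bound by (intro maximal_exists[of _ n B]) auto
  then obtain A where A: "finite A" "A \<subseteq> carrier_vec n" "lin_indpt A" "B \<subseteq> A"
    and Amax: "\<And>S. A \<subseteq> S \<Longrightarrow> S \<subseteq> carrier_vec n \<Longrightarrow> lin_indpt S \<Longrightarrow> S = A"
    by (auto simp: maximal_def)
  have "maximal A (\<lambda>S. S \<subseteq> carrier_vec n \<and> lin_indpt S)"
    using A Amax by (auto simp: maximal_def)
  hence basis: "basis A" by (rule max_li_is_basis)
  hence cA: "card A = n" and spA: "span A = carrier_vec n"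
    using dim_basis[OF A(1)] dim_is_n by (auto simp: basis_def)
  obtain bs where bs: "set bs = B" "distinct bs" using finite_distinct_list[OF B(1)] by auto
  obtain cs where cs: "set cs = A - B" "distinct cs" using finite_distinct_list[of "A - B"] A by auto
  define us where "us = bs @ cs"
  have us: "set us = A" "distinct us" using bs cs A by (auto simp: us_def)
  hence len: "length us = n" using cA distinct_card by metis
  define k where "k = length bs"
  have kn: "k \<le> n" using len by (auto simp: us_def k_def)
  define P where "P = mat_of_cols n us"
  have P: "P \<in> carrier_mat n n" by (auto simp: P_def len)
  obtain Q where Q: "Q \<in> carrier_mat n n" "P * Q = 1\<^sub>m n" "Q * P = 1\<^sub>m n"
    using mat_inverse_from_span[of us] us A len spA unfolding P_def by auto
  have colP: "col P j \<in> W" if "j < k" for j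
  proof -
    have "col P j = bs ! j" using that kn len A us
      by (auto simp: P_def us_def k_def nth_append in_mono intro!: col_mat_of_cols)
    thus ?thesis using that bs B by (auto simp: k_def)
  qed
  have Qw: "(Q *\<^sub>v w) $ i = 0" if w: "w \<in> W" and i: "k \<le> i" "i < n" for w i
  proof -
    have "w \<in> span_list bs" using WB[OF w] span_list_as_span[of bs] bs Bc by simp
    have dim: "\<forall>w\<in>set bs. dim_vec w = n" using bs Bc by (metis carrier_vecD subsetD)
    obtain c where "w = lincomb_list c bs" using \<open>w \<in> span_list bs\<close> by (auto simp: span_list_def)
    also have "\<dots> = mat_of_cols n bs *\<^sub>v vec k c"
      using lincomb_list_as_mat_mult[OF dim, of c] by (simp add: k_def)
    \<comment> \<open>The coordinates with respect to B are padded by zeros on the remaining basis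
      vectors; applying Q recovers exactly this padded vector.\<close>
    also have "\<dots> = P *\<^sub>v vec n (\<lambda>j. if j < k then c j else 0)" (is "_ = _ *\<^sub>v ?u")
    proof (rule eq_vecI)
      fix i assume "i < dim_vec (P *\<^sub>v ?u)"
      hence i: "i < n" using P by simp
      have "(P *\<^sub>v ?u) $ i = (\<Sum>j<n. P $$ (i, j) * (if j < k then c j else 0))"
        using i P by (auto simp: scalar_prod_def lessThan_atLeast0 intro!: sum.cong)
      also have "\<dots> = (\<Sum>j<k. P $$ (i, j) * c j)"
        using kn by (intro sum.mono_neutral_cong_right) auto
      also have "\<dots> = (\<Sum>j<k. mat_of_cols n bs $$ (i, j) * c j)"
        using i kn len by (intro sum.cong) (auto simp: P_def mat_of_cols_def us_def k_def nth_append)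
      also have "\<dots> = (mat_of_cols n bs *\<^sub>v vec k c) $ i"
        using i by (auto simp: scalar_prod_def lessThan_atLeast0 k_def intro!: sum.cong)
      finally show "(mat_of_cols n bs *\<^sub>v vec k c) $ i = (P *\<^sub>v ?u) $ i" by simp
    qed (use P in auto)
    finally have "Q *\<^sub>v w = Q *\<^sub>v (P *\<^sub>v ?u)" by simp
    also have "\<dots> = (Q * P) *\<^sub>v ?u"
      using assoc_mult_mat_vec[OF Q(1) P, of ?u] by simp
    also have "\<dots> = ?u" using Q by simp
    finally show ?thesis using i by simp
  qed
  \<comment> \<open>Both extremes are excluded by the nontriviality of W: an empty B would give W =
    0, and a B that is already a full basis would give the whole space.\<close>
  have "k \<noteq> 0"
  proof
    assume "k = 0"
    hence "B = {}" using bs by (simp add: k_def)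
    hence "W \<subseteq> {0\<^sub>v n}" using WB span_empty by auto
    thus False using nontriv W by auto
  qed
  moreover have "k \<noteq> n"
  proof
    assume k: "k = n"
    hence "cs = []" using len by (simp add: us_def k_def)
    hence "span_list bs = carrier_vec n"
      using cs A spA bs span_list_as_span[of bs] Bc by auto
    have closed: "lincomb_list c ws \<in> W" if "set ws \<subseteq> W" for c ws
      using that by (induction ws arbitrary: c) (auto intro: W add smult)
    have "v \<in> W" if v: "v \<in> carrier_vec n" for v
    proof -
      obtain c where "v = lincomb_list c bs"
        using v \<open>span_list bs = carrier_vec n\<close> unfolding span_list_def by blast
      thus ?thesis using closed bs B by blast
    qed
    thus False using nontriv W by auto
  qed
  ultimately show thesis using kn P Q colP Qw by (intro that[of k P Q]) auto
qed


text \<open>In a basis adapted to W every matrix is block upper triangular. Its diagonal blocks are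
  the action on W and on the quotient by W; each is multiplicative, and together they carry the
  trace. Both degrees are below n, as induction on the degree requires.\<close>

lemma (in group) split_rep:
  assumes r: "is_rep G n \<rho>"
    and W: "invariant_subspace G n \<rho> W" "W \<noteq> {0\<^sub>v n}" "W \<noteq> carrier_vec n"
  obtains k \<alpha> \<beta> where "k < n" "n - k < n" "is_rep G k \<alpha>" "is_rep G (n - k) \<beta>"
    "\<And>g. g \<in> carrier G \<Longrightarrow> mat_tr (\<rho> g) = mat_tr (\<alpha> g) + mat_tr (\<beta> g)"
proof -
  obtain k P Q where k: "0 < k" "k < n" and P: "P \<in> carrier_mat n n" and Q: "Q \<in> carrier_mat n n"
    and PQ: "P * Q = 1\<^sub>m n" and QP: "Q * P = 1\<^sub>m n"
    and colP: "\<And>j. j < k \<Longrightarrow> col P j \<in> W"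
    and QW: "\<And>w i. w \<in> W \<Longrightarrow> k \<le> i \<Longrightarrow> i < n \<Longrightarrow> (Q *\<^sub>v w) $ i = 0"
    using vec_space.adapted_basis[of W n] W by (auto simp: invariant_subspace_def)
  define M where "M g = Q * (\<rho> g * P)" for g
  have rc: "\<rho> g \<in> carrier_mat n n" if "g \<in> carrier G" for g using is_repD(1)[OF r that] .
  have M: "M g \<in> carrier_mat n n" if "g \<in> carrier G" for g
    using P Q rc[OF that] by (auto simp: M_def)
  have low: "M g $$ (i, j) = 0" if g: "g \<in> carrier G" and ij: "k \<le> i" "i < n" "j < k" for g i j
  proof -
    have j: "j < n" using ij k by simp
    have "col (M g) j = Q *\<^sub>v (\<rho> g *\<^sub>v col P j)"
      unfolding M_def using P Q rc[OF g] j by (simp add: col_mult2[of _ n n _ n])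
    moreover have "\<rho> g *\<^sub>v col P j \<in> W"
      using W(1) g colP[OF ij(3)] by (auto simp: invariant_subspace_def)
    moreover have "M g $$ (i, j) = col (M g) j $ i" using M[OF g] ij j by simp
    ultimately show ?thesis using QW ij by simp
  qed
  have Mmult: "M (g \<otimes> h) = M g * M h" if gh: "g \<in> carrier G" "h \<in> carrier G" for g h
  proof -
    note c = rc[OF gh(1)] rc[OF gh(2)]
    have "M g * M h = Q * (\<rho> g * (P * Q) * (\<rho> h * P))"
      unfolding M_def using P Q c by (simp add: assoc_mult_mat[of _ n n _ n _ n])
    also have "\<dots> = Q * (\<rho> g * (\<rho> h * P))" using PQ c by simp
    also have "\<dots> = M (g \<otimes> h)"
      unfolding M_def using P Q c is_repD(3)[OF r gh] by (simp add: assoc_mult_mat[of _ n n _ n _ n])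
    finally show ?thesis ..
  qed
  have Mone: "M \<one> = 1\<^sub>m n" using P Q QP is_repD(2)[OF r] by (simp add: M_def)
  have Mentry: "M (g \<otimes> h) $$ (i, j) = (\<Sum>l<n. M g $$ (i, l) * M h $$ (l, j))"
    if "g \<in> carrier G" "h \<in> carrier G" "i < n" "j < n" for g h i j
    using that by (simp add: Mmult mat_mult_entry[OF M M])
  define \<alpha> where "\<alpha> g = mat k k (\<lambda>(i, j). M g $$ (i, j))" for g
  define \<beta> where "\<beta> g = mat (n - k) (n - k) (\<lambda>(i, j). M g $$ (i + k, j + k))" for g
  have a: "is_rep G k \<alpha>"
    unfolding is_rep_def
  proof (intro conjI ballI)
    show "\<alpha> \<one> = 1\<^sub>m k" using k by (intro eq_matI) (auto simp: \<alpha>_def Mone)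
    fix g h assume gh: "g \<in> carrier G" "h \<in> carrier G"
    show "\<alpha> (g \<otimes> h) = \<alpha> g * \<alpha> h"
    proof (rule eq_matI)
      fix i j assume "i < dim_row (\<alpha> g * \<alpha> h)" "j < dim_col (\<alpha> g * \<alpha> h)"
      hence ij: "i < k" "j < k" by (auto simp: \<alpha>_def)
      have "\<alpha> (g \<otimes> h) $$ (i, j) = (\<Sum>l<n. M g $$ (i, l) * M h $$ (l, j))"
        using ij k by (simp add: \<alpha>_def Mentry[OF gh])
      \<comment> \<open>For l at least k the right factor is an entry of the zero block, since j <
        k.\<close>
      also have "\<dots> = (\<Sum>l<k. M g $$ (i, l) * M h $$ (l, j))"
        using k ij low[OF gh(2)] by (intro sum.mono_neutral_right) auto
      also have "\<dots> = (\<alpha> g * \<alpha> h) $$ (i, j)"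
        using ij by (subst mat_mult_entry[of _ k k _ k]) (auto simp: \<alpha>_def)
      finally show "\<alpha> (g \<otimes> h) $$ (i, j) = (\<alpha> g * \<alpha> h) $$ (i, j)" .
    qed (auto simp: \<alpha>_def)
  qed (auto simp: \<alpha>_def)
  have b: "is_rep G (n - k) \<beta>"
    unfolding is_rep_def
  proof (intro conjI ballI)
    show "\<beta> \<one> = 1\<^sub>m (n - k)" using k by (intro eq_matI) (auto simp: \<beta>_def Mone)
    fix g h assume gh: "g \<in> carrier G" "h \<in> carrier G"
    show "\<beta> (g \<otimes> h) = \<beta> g * \<beta> h"
    proof (rule eq_matI)
      fix i j assume "i < dim_row (\<beta> g * \<beta> h)" "j < dim_col (\<beta> g * \<beta> h)"
      hence ij: "i < n - k" "j < n - k" by (auto simp: \<beta>_def)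
      have "\<beta> (g \<otimes> h) $$ (i, j) = (\<Sum>l<n. M g $$ (i + k, l) * M h $$ (l, j + k))"
        using ij k by (simp add: \<beta>_def Mentry[OF gh])
      \<comment> \<open>Here the left factor lies in the zero block for l < k.\<close>
      also have "\<dots> = (\<Sum>l\<in>{k..<n}. M g $$ (i + k, l) * M h $$ (l, j + k))"
        using k ij low[OF gh(1)] by (intro sum.mono_neutral_right) auto
      also have "\<dots> = (\<Sum>l<n - k. M g $$ (i + k, l + k) * M h $$ (l + k, j + k))"
        by (rule sum.reindex_bij_witness[of _ "\<lambda>l. l + k" "\<lambda>l. l - k"]) auto
      also have "\<dots> = (\<beta> g * \<beta> h) $$ (i, j)"
        using ij by (subst mat_mult_entry[of _ "n - k" "n - k" _ "n - k"]) (auto simp: \<beta>_def)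
      finally show "\<beta> (g \<otimes> h) $$ (i, j) = (\<beta> g * \<beta> h) $$ (i, j)" .
    qed (auto simp: \<beta>_def)
  qed (auto simp: \<beta>_def)
  have tr: "mat_tr (\<rho> g) = mat_tr (\<alpha> g) + mat_tr (\<beta> g)" if g: "g \<in> carrier G" for g
  proof -
    have "mat_tr (M g) = mat_tr ((\<rho> g * P) * Q)"
      unfolding M_def using P Q rc[OF g] by (intro mat_tr_mult_comm) auto
    also have "(\<rho> g * P) * Q = \<rho> g"
      using PQ rc[OF g] assoc_mult_mat[OF rc[OF g] P Q] by simp
    finally have "mat_tr (\<rho> g) = (\<Sum>i<n. M g $$ (i, i))" using M[OF g] by (simp add: mat_tr_def)
    also have "\<dots> = (\<Sum>i<k. M g $$ (i, i)) + (\<Sum>i\<in>{k..<n}. M g $$ (i, i))"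
      using k by (subst sum.union_disjoint[symmetric]) (auto intro!: sum.cong)
    also have "(\<Sum>i\<in>{k..<n}. M g $$ (i, i)) = (\<Sum>i<n - k. M g $$ (i + k, i + k))"
      by (rule sum.reindex_bij_witness[of _ "\<lambda>l. l + k" "\<lambda>l. l - k"]) auto
    finally show ?thesis by (simp add: mat_tr_def \<alpha>_def \<beta>_def)
  qed
  show thesis by (rule that[OF _ _ a b tr]) (use k in auto)
qed

text \<open>Strong induction on the degree, splitting along an invariant subspace whenever there is
  a nontrivial one. A list is used because multiplicities matter; degree 0 gives the empty
  list.\<close>

lemma (in group) rep_trace_decomposition:
  assumes "is_rep G n \<rho>"
  shows "\<exists>\<psi>s. set \<psi>s \<subseteq> Irr G \<and> (\<forall>g\<in>carrier G. mat_tr (\<rho> g) = (\<Sum>\<psi>\<leftarrow>\<psi>s. \<psi> g))"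
  using assms
proof (induction n arbitrary: \<rho> rule: less_induct)
  case (less n)
  note r = less.prems
  consider "n = 0" | "irreducible_rep G n \<rho>"
    | W where "invariant_subspace G n \<rho> W" "W \<noteq> {0\<^sub>v n}" "W \<noteq> carrier_vec n"
    using r by (auto simp: irreducible_rep_def)
  thus ?case
  proof cases
    case 1
    have "mat_tr (\<rho> g) = 0" if "g \<in> carrier G" for g
      using is_repD(1)[OF r that] 1 by (simp add: mat_tr_def)
    thus ?thesis by (intro exI[of _ "[]"]) auto
  next
    case 2
    thus ?thesis by (intro exI[of _ "[character G \<rho>]"]) (auto simp: Irr_def character_def)
  next
    case (3 W)
    obtain k \<alpha> \<beta> where k: "k < n" "n - k < n" and rep: "is_rep G k \<alpha>" "is_rep G (n - k) \<beta>"
      and tr: "\<And>g. g \<in> carrier G \<Longrightarrow> mat_tr (\<rho> g) = mat_tr (\<alpha> g) + mat_tr (\<beta> g)"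
      using split_rep[OF r 3] by blast
    obtain as bs where "set as \<subseteq> Irr G" "\<forall>g\<in>carrier G. mat_tr (\<alpha> g) = (\<Sum>\<psi>\<leftarrow>as. \<psi> g)"
      "set bs \<subseteq> Irr G" "\<forall>g\<in>carrier G. mat_tr (\<beta> g) = (\<Sum>\<psi>\<leftarrow>bs. \<psi> g)"
      using less.IH[OF k(1) rep(1)] less.IH[OF k(2) rep(2)] by blast
    thus ?thesis by (intro exI[of _ "as @ bs"]) (auto simp: tr)
  qed
qed

section \<open>Column orthogonality\<close>

lemma IrrE:
  assumes "\<chi> \<in> Irr G"
  obtains \<rho> n where "irreducible_rep G n \<rho>" "\<chi> = character G \<rho>"
  using assms by (auto simp: Irr_def)

lemma (in group) Irr_one:
  assumes "\<chi> \<in> Irr G"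
  obtains d where "d > 0" "\<chi> \<one> = of_nat d"
proof -
  obtain \<rho> n where "irreducible_rep G n \<rho>" "\<chi> = character G \<rho>" using IrrE[OF assms] .
  thus thesis using that[of n] character_one[of n \<rho>] irreducible_repD(1,2)[of G n \<rho>] by simp
qed

lemma (in group) Irr_orthogonality:
  assumes "\<chi> \<in> Irr G" "\<psi> \<in> Irr G"
  shows "(\<Sum>g\<in>carrier G. \<chi> g * \<psi> (inv g)) = (if \<chi> = \<psi> then of_nat (card (carrier G)) else 0)"
proof -
  obtain \<rho> n where "irreducible_rep G n \<rho>" "\<chi> = character G \<rho>"
    using IrrE[OF assms(1)] .
  moreover obtain \<sigma> m where "irreducible_rep G m \<sigma>" "\<psi> = character G \<sigma>"
    using IrrE[OF assms(2)] .
  ultimately show ?thesis using character_orthogonal[of n \<rho> m \<sigma>] character_norm[of m \<sigma>] by simp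
qed

section \<open>Class functions and their expansion in irreducible characters\<close>

lemma mat_tr_conj:
  assumes "P \<in> carrier_mat n n" "Q \<in> carrier_mat n n" "A \<in> carrier_mat n n" "Q * P = 1\<^sub>m n"
  shows "mat_tr (P * A * Q) = mat_tr A"
proof -
  have "mat_tr (P * A * Q) = mat_tr (Q * (P * A))"
    using assms by (intro mat_tr_mult_comm) auto
  also have "Q * (P * A) = (Q * P) * A" using assoc_mult_mat[OF assms(2,1,3)] by simp
  finally show ?thesis using assms by simp
qed

lemma (in group) Irr_conj:
  assumes "\<chi> \<in> Irr G" "x \<in> carrier G" "y \<in> carrier G"
  shows "\<chi> (y \<otimes> x \<otimes> inv y) = \<chi> x"
proof -
  obtain \<rho> n where "irreducible_rep G n \<rho>" and \<chi>: "\<chi> = character G \<rho>"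
    using IrrE[OF assms(1)] .
  hence r: "is_rep G n \<rho>" by (simp add: irreducible_repD)
  have "\<rho> (inv y) * \<rho> y = 1\<^sub>m n"
    using is_repD(2)[OF r] is_repD(3)[OF r, of "inv y" y] assms by simp
  moreover have "\<rho> (y \<otimes> x \<otimes> inv y) = \<rho> y * \<rho> x * \<rho> (inv y)"
    using assms by (simp add: is_repD(3)[OF r])
  ultimately have "mat_tr (\<rho> (y \<otimes> x \<otimes> inv y)) = mat_tr (\<rho> x)"
    using mat_tr_conj[of "\<rho> y" n "\<rho> (inv y)" "\<rho> x"] is_repD(1)[OF r] assms by simp
  thus ?thesis using assms by (simp add: \<chi> character_def)
qed

lemma (in group) conj_eq_iff:
  assumes "z \<in> carrier G" "a \<in> carrier G" "g \<in> carrier G"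
  shows "inv z \<otimes> a \<otimes> z = g \<longleftrightarrow> a = z \<otimes> g \<otimes> inv z"
proof -
  have cancel: "inv z \<otimes> (z \<otimes> b) = b" "z \<otimes> (inv z \<otimes> b) = b" if "b \<in> carrier G" for b
    using assms that by (simp_all add: m_assoc[symmetric])
  show ?thesis using assms by (auto simp: m_assoc cancel)
qed

text \<open>The matrix Z, the sum of f(g) \<rho>(inv g), commutes with the representation because f
  is a class function, so it is a scalar c. The trace of Z is n c and the trace of Z \<rho>(x) is c
  \<chi>(x); eliminating c gives the identity.\<close>

lemma (in group) class_function_convolution:
  assumes \<chi>: "\<chi> \<in> Irr G" and x: "x \<in> carrier G"
    and f: "\<And>g y. g \<in> carrier G \<Longrightarrow> y \<in> carrier G \<Longrightarrow> f (y \<otimes> g \<otimes> inv y) = f g"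
  shows "\<chi> \<one> * (\<Sum>g\<in>carrier G. f g * \<chi> (inv g \<otimes> x)) = (\<Sum>g\<in>carrier G. f g * \<chi> (inv g)) * \<chi> x"
proof -
  obtain \<rho> n where \<rho>: "irreducible_rep G n \<rho>" and \<chi>: "\<chi> = character G \<rho>"
    using IrrE[OF \<chi>] .
  note r = irreducible_repD(1)[OF \<rho>]
  note rc = is_repD(1)[OF r]
  define Z where "Z = mat n n (\<lambda>(i, j). \<Sum>g\<in>carrier G. f g * \<rho> (inv g) $$ (i, j))"
  have Z: "Z \<in> carrier_mat n n" by (simp add: Z_def)
  have ZR: "(Z * \<rho> h) $$ (i, j) = (\<Sum>g\<in>carrier G. f g * \<rho> (inv g \<otimes> h) $$ (i, j))"
    if h: "h \<in> carrier G" and ij: "i < n" "j < n" for h i j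
  proof -
    have "(Z * \<rho> h) $$ (i, j) = (\<Sum>l<n. (\<Sum>g\<in>carrier G. f g * \<rho> (inv g) $$ (i, l)) * \<rho> h $$ (l, j))"
      using ij Z rc[OF h] by (subst mat_mult_entry[of _ n n _ n]) (auto simp: Z_def)
    also have "\<dots> = (\<Sum>g\<in>carrier G. f g * (\<Sum>l<n. \<rho> (inv g) $$ (i, l) * \<rho> h $$ (l, j)))"
      unfolding sum_distrib_left sum_distrib_right by (subst sum.swap) (simp add: mult.assoc)
    finally show ?thesis using h ij by (simp add: is_rep_mult_entry[OF r])
  qed
  have "\<rho> h * Z = Z * \<rho> h" if h: "h \<in> carrier G" for h
  proof (rule eq_matI)
    fix i j assume "i < dim_row (Z * \<rho> h)" "j < dim_col (Z * \<rho> h)"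
    hence ij: "i < n" "j < n" using Z rc[OF h] by auto
    have "(\<rho> h * Z) $$ (i, j) = (\<Sum>l<n. \<rho> h $$ (i, l) * (\<Sum>g\<in>carrier G. f g * \<rho> (inv g) $$ (l, j)))"
      using ij Z rc[OF h] by (subst mat_mult_entry[of _ n n _ n]) (auto simp: Z_def)
    also have "\<dots> = (\<Sum>g\<in>carrier G. f g * (\<Sum>l<n. \<rho> h $$ (i, l) * \<rho> (inv g) $$ (l, j)))"
      unfolding sum_distrib_left by (subst sum.swap) (simp add: mult.left_commute)
    also have "\<dots> = (\<Sum>g\<in>carrier G. f g * \<rho> (h \<otimes> inv g) $$ (i, j))"
      using h ij by (simp add: is_rep_mult_entry[OF r])
    \<comment> \<open>Invariance of f under conjugation is inserted so that the variable can be
      changed to the conjugate of g by h, whose inverse times h is h (inv g).\<close>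
    also have "\<dots> = (\<Sum>g\<in>carrier G. f (h \<otimes> g \<otimes> inv h) * \<rho> (h \<otimes> inv g) $$ (i, j))"
      using h f by simp
    also have "\<dots> = (\<Sum>g\<in>carrier G. f g * \<rho> (inv g \<otimes> h) $$ (i, j))"
    proof (rule sum.reindex_bij_witness[of _ "\<lambda>g. inv h \<otimes> g \<otimes> h" "\<lambda>g. h \<otimes> g \<otimes> inv h"])
      fix g assume g: "g \<in> carrier G"
      show "inv h \<otimes> (h \<otimes> g \<otimes> inv h) \<otimes> h = g" "h \<otimes> (inv h \<otimes> g \<otimes> h) \<otimes> inv h = g"
        using h g conj_eq_iff[of h "h \<otimes> g \<otimes> inv h" g] conj_eq_iff[of h g "inv h \<otimes> g \<otimes> h"]
        by simp_all
      have "inv (h \<otimes> g \<otimes> inv h) \<otimes> h = h \<otimes> inv g"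
        using h g by (simp add: m_assoc inv_mult_group)
      thus "f (h \<otimes> g \<otimes> inv h) * \<rho> (inv (h \<otimes> g \<otimes> inv h) \<otimes> h) $$ (i, j)
          = f (h \<otimes> g \<otimes> inv h) * \<rho> (h \<otimes> inv g) $$ (i, j)" by simp
    qed (use h in auto)
    finally show "(\<rho> h * Z) $$ (i, j) = (Z * \<rho> h) $$ (i, j)" using ZR[OF h ij] by simp
  qed (use Z rc[OF h] in auto)
  then obtain c where c: "\<And>i j. i < n \<Longrightarrow> j < n \<Longrightarrow> Z $$ (i, j) = (if i = j then c else 0)"
    using schur_scalar[OF \<rho> Z] by blast
  have tr: "\<chi> g = (\<Sum>i<n. \<rho> g $$ (i, i))" if "g \<in> carrier G" for g
    using that rc[OF that] by (simp add: \<chi> character_def mat_tr_def)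
  have 1: "(\<Sum>g\<in>carrier G. f g * \<chi> (inv g)) = of_nat n * c"
  proof -
    have "(\<Sum>g\<in>carrier G. f g * \<chi> (inv g)) = (\<Sum>i<n. Z $$ (i, i))"
    proof -
      have "(\<Sum>g\<in>carrier G. f g * \<chi> (inv g)) = (\<Sum>g\<in>carrier G. \<Sum>i<n. f g * \<rho> (inv g) $$ (i, i))"
        by (intro sum.cong refl) (simp add: tr sum_distrib_left)
      also have "\<dots> = (\<Sum>i<n. \<Sum>g\<in>carrier G. f g * \<rho> (inv g) $$ (i, i))" by (rule sum.swap)
      finally show ?thesis by (simp add: Z_def)
    qed
    thus ?thesis using c by simp
  qed
  have 2: "(\<Sum>g\<in>carrier G. f g * \<chi> (inv g \<otimes> x)) = c * \<chi> x"
  proof -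
    have "(\<Sum>g\<in>carrier G. f g * \<chi> (inv g \<otimes> x)) = (\<Sum>i<n. (Z * \<rho> x) $$ (i, i))"
    proof -
      have "(\<Sum>g\<in>carrier G. f g * \<chi> (inv g \<otimes> x))
          = (\<Sum>g\<in>carrier G. \<Sum>i<n. f g * \<rho> (inv g \<otimes> x) $$ (i, i))"
        using x by (intro sum.cong refl) (simp add: tr sum_distrib_left)
      also have "\<dots> = (\<Sum>i<n. \<Sum>g\<in>carrier G. f g * \<rho> (inv g \<otimes> x) $$ (i, i))" by (rule sum.swap)
      also have "\<dots> = (\<Sum>i<n. (Z * \<rho> x) $$ (i, i))" using ZR[OF x] by (intro sum.cong refl) simp
      finally show ?thesis .
    qed
    also have "\<dots> = (\<Sum>i<n. \<Sum>l<n. Z $$ (i, l) * \<rho> x $$ (l, i))"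
      using Z rc[OF x] by (intro sum.cong refl mat_mult_entry) auto
    also have "\<dots> = (\<Sum>i<n. \<Sum>l<n. if i = l then c * \<rho> x $$ (l, i) else 0)"
      using c by (intro sum.cong refl) auto
    finally show ?thesis using x by (simp add: tr sum_distrib_left)
  qed
  show ?thesis unfolding 1 2 using character_one[OF r] by (simp add: \<chi>)
qed

text \<open>This is the regular representation by permutation matrices, with e numbering the group
  elements. The trace counts fixed points of left multiplication by g, and there are none unless g
  is the identity.\<close>

lemma (in group) regular_character:
  assumes fin: "finite (carrier G)"
  obtains \<psi>s where "set \<psi>s \<subseteq> Irr G"
    "\<And>g. g \<in> carrier G \<Longrightarrow> (\<Sum>\<psi>\<leftarrow>\<psi>s. \<psi> g) = (if g = \<one> then of_nat (card (carrier G)) else 0)"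
proof -
  define N where "N = card (carrier G)"
  obtain e where e: "bij_betw e {..<N} (carrier G)"
    using ex_bij_betw_nat_finite[OF fin] by (auto simp: N_def lessThan_atLeast0)
  have ec: "e i \<in> carrier G" if "i < N" for i using e that by (auto simp: bij_betw_def)
  have einj: "e i = e j \<longleftrightarrow> i = j" if "i < N" "j < N" for i j
    using e that by (auto simp: bij_betw_def inj_on_def)
  define \<rho> where "\<rho> g = mat N N (\<lambda>(i, j). if e i = g \<otimes> e j then 1 else 0 :: complex)" for g
  have r: "is_rep G N \<rho>"
    unfolding is_rep_def
  proof (intro conjI ballI)
    show "\<rho> \<one> = 1\<^sub>m N" by (intro eq_matI) (auto simp: \<rho>_def ec einj)
    fix g h assume gh: "g \<in> carrier G" "h \<in> carrier G"
    show "\<rho> (g \<otimes> h) = \<rho> g * \<rho> h"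
    proof (rule eq_matI)
      fix i j assume "i < dim_row (\<rho> g * \<rho> h)" "j < dim_col (\<rho> g * \<rho> h)"
      hence ij: "i < N" "j < N" by (auto simp: \<rho>_def)
      have "h \<otimes> e j \<in> e ` {..<N}" using gh ec ij e by (simp add: bij_betw_def)
      then obtain m where m: "m < N" "e m = h \<otimes> e j" by (metis imageE lessThan_iff)
      have "(\<rho> g * \<rho> h) $$ (i, j)
          = (\<Sum>l<N. (if e i = g \<otimes> e l then 1 else 0) * (if e l = h \<otimes> e j then 1 else 0))"
        using ij by (subst mat_mult_entry[of _ N N _ N]) (auto simp: \<rho>_def intro!: sum.cong)
      \<comment> \<open>Only the index m of the element h (e j) contributes to the matrix
        product.\<close>
      also have "\<dots> = (\<Sum>l<N. if l = m then (if e i = g \<otimes> e m then 1 else 0) else 0)"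
        using m(1) by (intro sum.cong) (auto simp: m(2)[symmetric] einj)
      also have "\<dots> = \<rho> (g \<otimes> h) $$ (i, j)"
        using m ij gh ec by (simp add: \<rho>_def m_assoc)
      finally show "\<rho> (g \<otimes> h) $$ (i, j) = (\<rho> g * \<rho> h) $$ (i, j)" by simp
    qed (auto simp: \<rho>_def)
  qed (auto simp: \<rho>_def)
  have tr: "mat_tr (\<rho> g) = (if g = \<one> then of_nat N else 0)" if g: "g \<in> carrier G" for g
  proof -
    have "e i = g \<otimes> e i \<longleftrightarrow> g = \<one>" if "i < N" for i
      using r_cancel_one'[OF ec[OF that] g] .
    thus ?thesis by (simp add: mat_tr_def \<rho>_def)
  qed
  obtain \<psi>s where \<psi>s: "set \<psi>s \<subseteq> Irr G" "\<forall>g\<in>carrier G. mat_tr (\<rho> g) = (\<Sum>\<psi>\<leftarrow>\<psi>s. \<psi> g)"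
    using rep_trace_decomposition[OF r] by blast
  show thesis
  proof (rule that[OF \<psi>s(1)])
    fix g assume g: "g \<in> carrier G"
    show "(\<Sum>\<psi>\<leftarrow>\<psi>s. \<psi> g) = (if g = \<one> then of_nat (card (carrier G)) else 0)"
      using bspec[OF \<psi>s(2) g, symmetric] unfolding tr[OF g] N_def .
  qed
qed

text \<open>The regular character is |G| times the indicator of the identity, so convolving it with
  f returns |G| f(x). Convolving each constituent separately produces the right-hand side. The list
  is a parameter because its multiplicities are determined by applying this very identity.\<close>

lemma (in group) class_function_expansion_aux:
  assumes fin: "finite (carrier G)" and x: "x \<in> carrier G"
    and \<psi>s: "set \<psi>s \<subseteq> Irr G"
      "\<And>g. g \<in> carrier G \<Longrightarrow> (\<Sum>\<psi>\<leftarrow>\<psi>s. \<psi> g) = (if g = \<one> then of_nat (card (carrier G)) else 0)"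
    and f: "\<And>g y. g \<in> carrier G \<Longrightarrow> y \<in> carrier G \<Longrightarrow> f (y \<otimes> g \<otimes> inv y) = f g"
  shows "of_nat (card (carrier G)) * f x
    = (\<Sum>\<psi>\<leftarrow>\<psi>s. (\<Sum>g\<in>carrier G. f g * \<psi> (inv g)) * \<psi> x / \<psi> \<one>)"
proof -
  have "(\<Sum>\<psi>\<leftarrow>\<psi>s. (\<Sum>g\<in>carrier G. f g * \<psi> (inv g)) * \<psi> x / \<psi> \<one>)
      = (\<Sum>\<psi>\<leftarrow>\<psi>s. \<Sum>g\<in>carrier G. f g * \<psi> (inv g \<otimes> x))"
  proof (intro arg_cong[of _ _ sum_list] map_cong refl)
    fix \<psi> assume "\<psi> \<in> set \<psi>s"
    hence \<psi>: "\<psi> \<in> Irr G" using \<psi>s by auto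
    obtain d where "d > 0" "\<psi> \<one> = of_nat d" using Irr_one[OF \<psi>] .
    thus "(\<Sum>g\<in>carrier G. f g * \<psi> (inv g)) * \<psi> x / \<psi> \<one> = (\<Sum>g\<in>carrier G. f g * \<psi> (inv g \<otimes> x))"
      using class_function_convolution[of \<psi> x f, OF \<psi> x f, symmetric] by simp
  qed
  also have "\<dots> = (\<Sum>g\<in>carrier G. f g * (\<Sum>\<psi>\<leftarrow>\<psi>s. \<psi> (inv g \<otimes> x)))"
    by (induction \<psi>s) (simp_all add: sum.distrib distrib_left)
  also have "\<dots> = (\<Sum>g\<in>carrier G. if g = x then f g * of_nat (card (carrier G)) else 0)"
  proof (intro sum.cong refl)
    fix g assume g: "g \<in> carrier G"
    have "inv g \<otimes> x = \<one> \<longleftrightarrow> g = x"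
      using g x inv_equality[of "inv g" x] by auto
    thus "f g * (\<Sum>\<psi>\<leftarrow>\<psi>s. \<psi> (inv g \<otimes> x)) = (if g = x then f g * of_nat (card (carrier G)) else 0)"
      using \<psi>s(2)[of "inv g \<otimes> x"] g x by simp
  qed
  also have "\<dots> = of_nat (card (carrier G)) * f x" using fin x by simp
  finally show ?thesis ..
qed

text \<open>Take f = \<chi> and x the identity in the expansion: by row orthogonality only the
  copies of \<chi> in the list survive, each contributing |G|.\<close>

lemma (in group) Irr_multiplicity_regular:
  assumes fin: "finite (carrier G)" and \<chi>: "\<chi> \<in> Irr G"
    and \<psi>s: "set \<psi>s \<subseteq> Irr G"
      "\<And>g. g \<in> carrier G \<Longrightarrow> (\<Sum>\<psi>\<leftarrow>\<psi>s. \<psi> g) = (if g = \<one> then of_nat (card (carrier G)) else 0)"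
  shows "of_nat (count_list \<psi>s \<chi>) = \<chi> \<one>"
proof -
  obtain d where d: "d > 0" "\<chi> \<one> = of_nat d" using Irr_one[OF \<chi>] .
  let ?N = "of_nat (card (carrier G)) :: complex"
  have N: "?N \<noteq> 0" using fin by (auto simp: card_eq_0_iff)
  have "?N * \<chi> \<one> = (\<Sum>\<psi>\<leftarrow>\<psi>s. (\<Sum>g\<in>carrier G. \<chi> g * \<psi> (inv g)) * \<psi> \<one> / \<psi> \<one>)"
    using class_function_expansion_aux[of \<one> \<psi>s \<chi>, OF fin _ \<psi>s] Irr_conj[OF \<chi>] by simp
  also have "\<dots> = (\<Sum>\<psi>\<leftarrow>\<psi>s. if \<psi> = \<chi> then ?N else 0)"
  proof (intro arg_cong[of _ _ sum_list] map_cong refl)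
    fix \<psi> assume "\<psi> \<in> set \<psi>s"
    hence \<psi>: "\<psi> \<in> Irr G" using \<psi>s by auto
    show "(\<Sum>g\<in>carrier G. \<chi> g * \<psi> (inv g)) * \<psi> \<one> / \<psi> \<one> = (if \<psi> = \<chi> then ?N else 0)"
      using Irr_orthogonality[OF \<chi> \<psi>] d by auto
  qed
  also have "\<dots> = ?N * of_nat (count_list \<psi>s \<chi>)"
    by (induction \<psi>s) (auto simp: algebra_simps)
  finally show ?thesis using N by simp
qed

text \<open>The multiplicity in the regular character is the degree, which is positive, so every
  irreducible character appears in one finite list.\<close>

lemma (in group) Irr_finite:
  assumes fin: "finite (carrier G)" shows "finite (Irr G)"
proof -
  obtain \<psi>s where \<psi>s: "set \<psi>s \<subseteq> Irr G"
      "\<And>g. g \<in> carrier G \<Longrightarrow> (\<Sum>\<psi>\<leftarrow>\<psi>s. \<psi> g) = (if g = \<one> then of_nat (card (carrier G)) else 0)"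
    using regular_character[OF fin] by blast
  have "\<chi> \<in> set \<psi>s" if \<chi>: "\<chi> \<in> Irr G" for \<chi>
  proof -
    obtain d where "d > 0" "\<chi> \<one> = of_nat d" using Irr_one[OF \<chi>] .
    hence "count_list \<psi>s \<chi> \<noteq> 0" using Irr_multiplicity_regular[OF fin \<chi> \<psi>s] by auto
    thus ?thesis by (simp add: count_list_0_iff)
  qed
  hence "Irr G \<subseteq> set \<psi>s" by blast
  thus ?thesis using finite_subset by blast
qed

text \<open>Collecting equal entries of the list gives each \<psi> the factor \<psi>(1), which
  cancels the denominator in the expansion over the list.\<close>

lemma (in group) class_function_expansion:
  assumes fin: "finite (carrier G)" and x: "x \<in> carrier G"
    and f: "\<And>g y. g \<in> carrier G \<Longrightarrow> y \<in> carrier G \<Longrightarrow> f (y \<otimes> g \<otimes> inv y) = f g"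
  shows "of_nat (card (carrier G)) * f x = (\<Sum>\<psi>\<in>Irr G. (\<Sum>g\<in>carrier G. f g * \<psi> (inv g)) * \<psi> x)"
proof -
  obtain \<psi>s where \<psi>s: "set \<psi>s \<subseteq> Irr G"
      "\<And>g. g \<in> carrier G \<Longrightarrow> (\<Sum>\<psi>\<leftarrow>\<psi>s. \<psi> g) = (if g = \<one> then of_nat (card (carrier G)) else 0)"
    using regular_character[OF fin] by blast
  let ?F = "\<lambda>\<psi>. (\<Sum>g\<in>carrier G. f g * \<psi> (inv g)) * \<psi> x"
  have "of_nat (card (carrier G)) * f x = (\<Sum>\<psi>\<leftarrow>\<psi>s. ?F \<psi> / \<psi> \<one>)"
    by (rule class_function_expansion_aux[OF fin x \<psi>s f])
  also have "\<dots> = (\<Sum>\<psi>\<in>Irr G. of_nat (count_list \<psi>s \<psi>) * (?F \<psi> / \<psi> \<one>))"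
    using \<psi>s(1)
  proof (induction \<psi>s)
    case (Cons a as)
    have "(\<Sum>\<psi>\<in>Irr G. of_nat (count_list (a # as) \<psi>) * (?F \<psi> / \<psi> \<one>))
        = (\<Sum>\<psi>\<in>Irr G. of_nat (count_list as \<psi>) * (?F \<psi> / \<psi> \<one>) + (if \<psi> = a then ?F \<psi> / \<psi> \<one> else 0))"
      by (intro sum.cong) (auto simp: algebra_simps add_divide_distrib)
    also have "\<dots> = (\<Sum>\<psi>\<in>Irr G. of_nat (count_list as \<psi>) * (?F \<psi> / \<psi> \<one>)) + ?F a / a \<one>"
      using Cons.prems Irr_finite[OF fin] by (simp add: sum.distrib)
    finally show ?case using Cons by simp
  qed simp
  also have "\<dots> = (\<Sum>\<psi>\<in>Irr G. ?F \<psi>)"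
  proof (intro sum.cong refl)
    fix \<psi> assume \<psi>: "\<psi> \<in> Irr G"
    obtain d where "d > 0" "\<psi> \<one> = of_nat d" using Irr_one[OF \<psi>] .
    thus "of_nat (count_list \<psi>s \<psi>) * (?F \<psi> / \<psi> \<one>) = ?F \<psi>"
      using Irr_multiplicity_regular[OF fin \<psi> \<psi>s] by simp
  qed
  finally show ?thesis .
qed

text \<open>The expansion is applied to f(g), the number of y conjugating h to g, which is the
  indicator of the conjugacy class of h scaled by the order of the centralizer. Counting conjugators
  keeps class sizes out of the formula.\<close>

lemma (in group) column_orthogonality:
  assumes fin: "finite (carrier G)" and x: "x \<in> carrier G" and h: "h \<in> carrier G"
  shows "(\<Sum>\<psi>\<in>Irr G. \<psi> (inv h) * \<psi> x) = of_nat (card {y \<in> carrier G. y \<otimes> h \<otimes> inv y = x})"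
proof -
  let ?N = "of_nat (card (carrier G)) :: complex"
  have N: "?N \<noteq> 0" using fin by (auto simp: card_eq_0_iff)
  define f where "f g = (\<Sum>y\<in>carrier G. if y \<otimes> h \<otimes> inv y = g then 1 else 0 :: complex)" for g
  have cls: "f (z \<otimes> g \<otimes> inv z) = f g" if gz: "g \<in> carrier G" "z \<in> carrier G" for g z
    unfolding f_def
  proof (rule sum.reindex_bij_witness[of _ "\<lambda>y. z \<otimes> y" "\<lambda>y. inv z \<otimes> y"])
    fix y assume y: "y \<in> carrier G"
    have "inv z \<otimes> y \<otimes> h \<otimes> inv (inv z \<otimes> y) = inv z \<otimes> (y \<otimes> h \<otimes> inv y) \<otimes> z"
      using gz y h by (simp add: m_assoc inv_mult_group)
    hence "inv z \<otimes> y \<otimes> h \<otimes> inv (inv z \<otimes> y) = g \<longleftrightarrow> y \<otimes> h \<otimes> inv y = z \<otimes> g \<otimes> inv z"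
      using conj_eq_iff[of z "y \<otimes> h \<otimes> inv y" g] gz y h by simp
    thus "(if inv z \<otimes> y \<otimes> h \<otimes> inv (inv z \<otimes> y) = g then 1 else 0)
      = (if y \<otimes> h \<otimes> inv y = z \<otimes> g \<otimes> inv z then 1 else 0 :: complex)" by simp
  qed (use gz in \<open>auto simp: m_assoc[symmetric]\<close>)
  \<comment> \<open>Every y contributes the value of \<psi> at a conjugate of inv h, so the pairing
    is |G| equal terms.\<close>
  have pairing: "(\<Sum>g\<in>carrier G. f g * \<psi> (inv g)) = ?N * \<psi> (inv h)" if \<psi>: "\<psi> \<in> Irr G" for \<psi>
  proof -
    have "(\<Sum>g\<in>carrier G. f g * \<psi> (inv g))
       = (\<Sum>y\<in>carrier G. \<Sum>g\<in>carrier G. if y \<otimes> h \<otimes> inv y = g then \<psi> (inv g) else 0)"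
      unfolding f_def sum_distrib_right by (subst sum.swap) (intro sum.cong refl, simp)
    also have "\<dots> = (\<Sum>y\<in>carrier G. \<psi> (inv (y \<otimes> h \<otimes> inv y)))"
      using fin h by (intro sum.cong refl) simp
    also have "\<dots> = (\<Sum>y\<in>carrier G. \<psi> (y \<otimes> inv h \<otimes> inv y))"
      using h by (intro sum.cong refl) (simp add: inv_mult_group m_assoc)
    also have "\<dots> = ?N * \<psi> (inv h)" using Irr_conj[OF \<psi>] h by simp
    finally show ?thesis .
  qed
  have "?N * f x = (\<Sum>\<psi>\<in>Irr G. ?N * \<psi> (inv h) * \<psi> x)"
    using class_function_expansion[of x f, OF fin x cls] pairing by simp
  also have "\<dots> = ?N * (\<Sum>\<psi>\<in>Irr G. \<psi> (inv h) * \<psi> x)" by (simp add: sum_distrib_left mult.assoc)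
  finally have "f x = (\<Sum>\<psi>\<in>Irr G. \<psi> (inv h) * \<psi> x)" using N by simp
  moreover have "f x = of_nat (card {y \<in> carrier G. y \<otimes> h \<otimes> inv y = x})"
    using fin by (simp add: f_def sum.inter_filter[symmetric])
  ultimately show ?thesis by simp
qed

section \<open>Restriction to a subgroup and the rank\<close>

lemma (in group) trivial_rep_irreducible: "irreducible_rep G 1 (\<lambda>_. 1\<^sub>m 1)"
proof -
  have "W = carrier_vec 1" if W: "invariant_subspace G 1 (\<lambda>_. 1\<^sub>m 1) W" and ne: "W \<noteq> {0\<^sub>v 1}" for W
  proof -
    have Wc: "W \<subseteq> carrier_vec 1" "0\<^sub>v 1 \<in> W" and sm: "\<And>c v. v \<in> W \<Longrightarrow> c \<cdot>\<^sub>v v \<in> W"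
      using W by (auto simp: invariant_subspace_def)
    then obtain v where v: "v \<in> W" "v \<noteq> 0\<^sub>v 1" using ne by auto
    hence vc: "v \<in> carrier_vec 1" using Wc by auto
    have v0: "v $ 0 \<noteq> 0"
    proof
      assume "v $ 0 = 0"
      hence "v = 0\<^sub>v 1" using vc by (intro eq_vecI) auto
      thus False using v by simp
    qed
    have "u \<in> W" if u: "u \<in> carrier_vec 1" for u
    proof -
      have "(u $ 0 / v $ 0) \<cdot>\<^sub>v v = u" using u vc v0 by (intro eq_vecI) auto
      with sm[OF v(1), of "u $ 0 / v $ 0"] show ?thesis by simp
    qed
    thus ?thesis using Wc by auto
  qed
  thus ?thesis unfolding irreducible_rep_def is_rep_def by auto
qed

text \<open>The sum of a character over the group is its pairing with the trivial character.\<close>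

lemma (in group) Irr_sum_eq:
  assumes \<psi>: "\<psi> \<in> Irr G"
  shows "(\<Sum>g\<in>carrier G. \<psi> g)
    = (if \<psi> = character G (\<lambda>_. 1\<^sub>m 1) then of_nat (card (carrier G)) else 0)"
proof -
  let ?t = "character G (\<lambda>_. 1\<^sub>m 1)"
  have "?t \<in> Irr G" unfolding Irr_def using trivial_rep_irreducible by blast
  moreover have "(\<Sum>g\<in>carrier G. \<psi> g) = (\<Sum>g\<in>carrier G. \<psi> g * ?t (inv g))"
    by (intro sum.cong) (auto simp: character_def)
  ultimately show ?thesis using Irr_orthogonality[OF \<psi>, of ?t] by simp
qed

text \<open>Restrict to H and split the trace: among the constituents only copies of the trivial
  character have a nonzero sum over H. Here m counts these copies.\<close>

lemma (in group) Irr_subgroup_multiplicity: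
  assumes H: "subgroup H G" and \<chi>: "\<chi> \<in> Irr G"
  obtains m d :: nat where "(\<Sum>h\<in>H. \<chi> h) = of_nat (card H) * of_nat m" "\<chi> \<one> = of_nat d" "m \<le> d"
proof -
  obtain \<rho> n where \<rho>: "irreducible_rep G n \<rho>" and \<chi>: "\<chi> = character G \<rho>"
    using IrrE[OF \<chi>] .
  note r = irreducible_repD(1)[OF \<rho>]
  define K where "K = G\<lparr>carrier := H\<rparr>"
  interpret K: group K unfolding K_def by (rule subgroup.subgroup_is_group[OF H is_group])
  have K_simps: "carrier K = H" "one K = \<one>" by (simp_all add: K_def)
  have HG: "H \<subseteq> carrier G" using H by (rule subgroup.subset)
  have "is_rep K n \<rho>" using r HG by (auto simp: is_rep_def K_def)
  from K.rep_trace_decomposition[OF this]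
  obtain \<psi>s where \<psi>s: "set \<psi>s \<subseteq> Irr K" and tr: "\<forall>h\<in>H. mat_tr (\<rho> h) = (\<Sum>\<psi>\<leftarrow>\<psi>s. \<psi> h)"
    unfolding K_simps by blast
  define t where "t = character K (\<lambda>_. 1\<^sub>m 1)"
  have "(\<Sum>h\<in>H. \<chi> h) = (\<Sum>h\<in>H. \<Sum>\<psi>\<leftarrow>\<psi>s. \<psi> h)"
    using HG tr by (intro sum.cong) (auto simp: \<chi> character_def)
  also have "\<dots> = (\<Sum>\<psi>\<leftarrow>\<psi>s. \<Sum>h\<in>H. \<psi> h)"
    by (induction \<psi>s) (simp_all add: sum.distrib)
  also have "\<dots> = (\<Sum>\<psi>\<leftarrow>\<psi>s. if \<psi> = t then of_nat (card H) else 0)"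
  proof (intro arg_cong[of _ _ sum_list] map_cong refl)
    fix \<psi> assume "\<psi> \<in> set \<psi>s"
    hence "\<psi> \<in> Irr K" using \<psi>s by auto
    thus "(\<Sum>h\<in>H. \<psi> h) = (if \<psi> = t then of_nat (card H) else 0)"
      using K.Irr_sum_eq[of \<psi>] unfolding K_simps t_def by simp
  qed
  also have "\<dots> = of_nat (card H) * of_nat (count_list \<psi>s t)"
    by (induction \<psi>s) (auto simp: algebra_simps)
  finally have 1: "(\<Sum>h\<in>H. \<chi> h) = of_nat (card H) * of_nat (count_list \<psi>s t)" .
  \<comment> \<open>Each constituent has degree at least 1 and the degrees add up to n, so the list
    has at most n entries, and hence m \<le> d.\<close>
  have "real (length \<psi>s) \<le> Re (\<Sum>\<psi>\<leftarrow>\<psi>s. \<psi> \<one>)"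
    using \<psi>s
  proof (induction \<psi>s)
    case (Cons a as)
    obtain d where "d > 0" "a \<one> = of_nat d" using K.Irr_one[of a] Cons.prems K_simps by auto
    thus ?case using Cons by simp
  qed simp
  also have "(\<Sum>\<psi>\<leftarrow>\<psi>s. \<psi> \<one>) = of_nat n"
    using bspec[OF tr subgroup.one_closed[OF H]] is_repD(2)[OF r] by simp
  finally have "length \<psi>s \<le> n" by simp
  hence "count_list \<psi>s t \<le> n" by (rule le_trans[OF count_le_length])
  with 1 show thesis using character_one[OF r] by (intro that[of "count_list \<psi>s t" n]) (simp_all add: \<chi>)
qed

section \<open>The action on right cosets and orbit counting\<close>

lemma (in group) r_coset_eq_iff:
  assumes H: "subgroup H G" and ab: "a \<in> carrier G" "b \<in> carrier G"
  shows "H #> a = H #> b \<longleftrightarrow> a \<otimes> inv b \<in> H"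
proof -
  have "a \<in> H #> b \<longleftrightarrow> a \<otimes> inv b \<in> H" using subgroup.rcos_module[OF H is_group ab(2,1)] .
  moreover have "H #> a = H #> b \<longleftrightarrow> a \<in> H #> b"
    using rcos_self[OF ab(1) H] repr_independence[of a H b] H ab by auto
  ultimately show ?thesis by simp
qed

lemma (in group) r_coset_fixed_iff:
  assumes H: "subgroup H G" and yh: "y \<in> carrier G" "h \<in> carrier G"
  shows "(H #> y) #> inv h = H #> y \<longleftrightarrow> y \<otimes> h \<otimes> inv y \<in> H"
proof -
  have "(H #> y) #> inv h = H #> (y \<otimes> inv h)"
    using subgroup.subset[OF H] yh by (intro coset_mult_assoc) auto
  hence "(H #> y) #> inv h = H #> y \<longleftrightarrow> y \<otimes> inv h \<otimes> inv y \<in> H"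
    using r_coset_eq_iff[OF H, of "y \<otimes> inv h" y] yh by simp
  also have "y \<otimes> inv h \<otimes> inv y = inv (y \<otimes> h \<otimes> inv y)"
    using yh by (simp add: inv_mult_group m_assoc)
  also have "\<dots> \<in> H \<longleftrightarrow> y \<otimes> h \<otimes> inv y \<in> H"
  proof
    assume "inv (y \<otimes> h \<otimes> inv y) \<in> H"
    hence "inv (inv (y \<otimes> h \<otimes> inv y)) \<in> H" by (rule subgroup.m_inv_closed[OF H])
    thus "y \<otimes> h \<otimes> inv y \<in> H" using yh by simp
  qed (rule subgroup.m_inv_closed[OF H])
  finally show ?thesis .
qed

text \<open>\<open>group_action\<close> asks for a homomorphism into bijections under composition,
  that is, a left action. Right multiplication becomes one after inverting h.\<close>

lemma (in group) rcosets_action: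
  assumes H: "subgroup H G"
  shows "group_action (G\<lparr>carrier := H\<rparr>) (rcosets H) (\<lambda>h. \<lambda>X\<in>rcosets H. X #> inv h)"
proof -
  let ?E = "rcosets H" and ?K = "G\<lparr>carrier := H\<rparr>"
  let ?\<phi> = "\<lambda>h. \<lambda>X\<in>rcosets H. X #> inv h"
  have HG: "H \<subseteq> carrier G" using H by (rule subgroup.subset)
  have Hinv: "inv h \<in> H" if "h \<in> H" for h using subgroup.m_inv_closed[OF H that] .
  have E_sub: "X \<subseteq> carrier G" if "X \<in> ?E" for X
    using subgroup.rcosets_carrier[OF H is_group that] .
  have closed: "X #> h \<in> ?E" if X: "X \<in> ?E" and h: "h \<in> carrier G" for X h
  proof -
    obtain a where a: "a \<in> carrier G" "X = H #> a" using X by (auto simp: RCOSETS_def)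
    hence "X #> h = H #> (a \<otimes> h)" using h HG by (simp add: coset_mult_assoc)
    thus ?thesis using a h HG by (simp add: rcosetsI)
  qed
  have Bij: "?\<phi> h \<in> Bij ?E" if h: "h \<in> H" for h
  proof -
    have hG: "h \<in> carrier G" using h HG by auto
    have "bij_betw (?\<phi> h) ?E ?E"
    proof (rule bij_betw_byWitness[where f' = "\<lambda>X. X #> h"])
      show "\<forall>X\<in>?E. ?\<phi> h X #> h = X"
        using hG E_sub by (auto simp: coset_mult_assoc)
      show "\<forall>X\<in>?E. ?\<phi> h (X #> h) = X"
        using hG E_sub closed by (auto simp: coset_mult_assoc)
    qed (use closed hG in auto)
    thus ?thesis by (simp add: Bij_def)
  qed
  have "?\<phi> \<in> hom ?K (BijGroup ?E)"
  proof (rule homI)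
    fix h k assume "h \<in> carrier ?K" "k \<in> carrier ?K"
    hence hk: "h \<in> H" "k \<in> H" and hkG: "h \<in> carrier G" "k \<in> carrier G" using HG by auto
    have "?\<phi> (h \<otimes> k) = compose ?E (?\<phi> h) (?\<phi> k)"
      using hkG E_sub closed by (intro ext) (auto simp: compose_def inv_mult_group coset_mult_assoc)
    thus "?\<phi> (h \<otimes>\<^bsub>?K\<^esub> k) = ?\<phi> h \<otimes>\<^bsub>BijGroup ?E\<^esub> ?\<phi> k"
      using Bij[OF hk(1)] Bij[OF hk(2)] by (simp add: BijGroup_def)
  qed (use Bij in \<open>auto simp: BijGroup_def\<close>)
  thus ?thesis
    using group_BijGroup subgroup.subgroup_is_group[OF H is_group]
    by (intro group_action.intro group_hom.intro group_hom_axioms.intro)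
qed

text \<open>Burnside's lemma accounts for one factor |H|. The other comes from replacing each fixed
  coset by its |H| elements y, which are exactly those that conjugate h into H.\<close>

lemma (in group) rank_coset_eq:
  assumes fin: "finite (carrier G)" and H: "subgroup H G"
  shows "rank_coset G H * card H ^ 2 = (\<Sum>h\<in>H. card {y \<in> carrier G. y \<otimes> h \<otimes> inv y \<in> H})"
proof -
  let ?E = "rcosets H" and ?K = "G\<lparr>carrier := H\<rparr>"
  let ?\<phi> = "\<lambda>h. \<lambda>X\<in>rcosets H. X #> inv h"
  have HG: "H \<subseteq> carrier G" using H by (rule subgroup.subset)
  interpret act: group_action ?K ?E ?\<phi> by (rule rcosets_action[OF H])
  have finE: "finite ?E" using rcosets_subset_PowG[OF H] fin by (simp add: finite_subset)
  have orb: "orbit ?K ?\<phi> X = {X #> h | h. h \<in> H}" if X: "X \<in> ?E" for X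
  proof -
    \<comment> \<open>As h runs through H so does its inverse, so the orbits of the inverted action
      are the suborbits.\<close>
    have "orbit ?K ?\<phi> X = {X #> inv h | h. h \<in> H}" using X by (auto simp: orbit_def)
    also have "\<dots> = {X #> h | h. h \<in> H}"
    proof (intro equalityI subsetI)
      fix Y assume "Y \<in> {X #> h | h. h \<in> H}"
      then obtain h where h: "h \<in> H" "Y = X #> h" by blast
      hence "Y = X #> inv (inv h)" using HG by auto
      thus "Y \<in> {X #> inv h | h. h \<in> H}" using h subgroup.m_inv_closed[OF H] by blast
    qed (use subgroup.m_inv_closed[OF H] in blast)
    finally show ?thesis .
  qed
  hence "orbits ?K ?E ?\<phi> = suborbits G H" unfolding orbits_def suborbits_def by blast
  hence burnside: "rank_coset G H * card H = (\<Sum>h\<in>H. card {X \<in> ?E. X #> inv h = X})"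
    using act.burnside[OF _ finE] finite_subset[OF HG fin]
    by (simp add: rank_coset_def Coset.order_def invariants_def cong: conj_cong)
  have fib: "card {X \<in> ?E. X #> inv h = X} * card H = card {y \<in> carrier G. y \<otimes> h \<otimes> inv y \<in> H}"
    if h: "h \<in> H" for h
  proof -
    let ?F = "{X \<in> ?E. X #> inv h = X}"
    have "card H * card ?F = card (\<Union>?F)"
    proof (rule card_partition)
      show "finite ?F" using finE by simp
      show "finite (\<Union>?F)"
        using fin subgroup.rcosets_carrier[OF H is_group] by (intro finite_subset[OF _ fin]) auto
      show "card X = card H" if "X \<in> ?F" for X
        using card_cosets_equal[of X H] that HG by (auto dest: bij_betw_same_card)
      show "X \<inter> Y = {}" if "X \<in> ?F" "Y \<in> ?F" "X \<noteq> Y" for X Y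
        using rcos_disjoint[OF H] that by (auto simp: pairwise_def disjnt_def)
    qed
    also have "\<Union>?F = {y \<in> carrier G. y \<otimes> h \<otimes> inv y \<in> H}"
    proof (intro equalityI subsetI)
      fix y assume "y \<in> \<Union>?F"
      then obtain X where X: "X \<in> ?E" "X #> inv h = X" "y \<in> X" by auto
      then obtain a where a: "a \<in> carrier G" "X = H #> a" by (auto simp: RCOSETS_def)
      have y: "y \<in> carrier G" using X subgroup.rcosets_carrier[OF H is_group X(1)] by auto
      have "X = H #> y" using repr_independence[of y H a] a X H by simp
      thus "y \<in> {y \<in> carrier G. y \<otimes> h \<otimes> inv y \<in> H}"
        using r_coset_fixed_iff[OF H y, of h] h HG X y by auto
    next
      fix y assume "y \<in> {y \<in> carrier G. y \<otimes> h \<otimes> inv y \<in> H}"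
      hence y: "y \<in> carrier G" "y \<otimes> h \<otimes> inv y \<in> H" by auto
      hence "H #> y \<in> ?F" using r_coset_fixed_iff[OF H y(1), of h] h HG by (auto intro: rcosetsI)
      thus "y \<in> \<Union>?F" using rcos_self[OF y(1) H] by blast
    qed
    finally show ?thesis by (simp add: mult.commute)
  qed
  have "rank_coset G H * card H ^ 2 = (\<Sum>h\<in>H. card {X \<in> ?E. X #> inv h = X} * card H)"
    by (simp add: power2_eq_square burnside[symmetric] sum_distrib_right[symmetric] mult.assoc[symmetric])
  thus ?thesis using fib by simp
qed

section \<open>The lower bound for the distance\<close>

text \<open>Both sides count pairs (h, y) with h in H and the conjugate of h by y again in H. For
  fixed y, conjugation maps the admissible h bijectively onto the intersection of H with its
  conjugate.\<close>

lemma (in group) conj_fixed_sum_swap: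
  assumes fin: "finite (carrier G)" and H: "subgroup H G"
  shows "(\<Sum>h\<in>H. card {y \<in> carrier G. y \<otimes> h \<otimes> inv y \<in> H})
    = (\<Sum>y\<in>carrier G. card (H \<inter> ((y <# H) #> inv y)))"
proof -
  have HG: "H \<subseteq> carrier G" using H by (rule subgroup.subset)
  have finH: "finite H" using HG fin by (rule finite_subset)
  have "card {h \<in> H. y \<otimes> h \<otimes> inv y \<in> H} = card (H \<inter> ((y <# H) #> inv y))"
    if y: "y \<in> carrier G" for y
  proof (rule bij_betw_same_card[of "\<lambda>h. y \<otimes> h \<otimes> inv y"], unfold bij_betw_def, intro conjI)
    show "inj_on (\<lambda>h. y \<otimes> h \<otimes> inv y) {h \<in> H. y \<otimes> h \<otimes> inv y \<in> H}"
      using y HG by (intro inj_onI) (auto simp: subset_iff)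
    show "(\<lambda>h. y \<otimes> h \<otimes> inv y) ` {h \<in> H. y \<otimes> h \<otimes> inv y \<in> H} = H \<inter> ((y <# H) #> inv y)"
      by (auto simp: l_coset_def r_coset_def)
  qed
  moreover have "(\<Sum>h\<in>H. card {y \<in> carrier G. y \<otimes> h \<otimes> inv y \<in> H})
      = (\<Sum>y\<in>carrier G. card {h \<in> H. y \<otimes> h \<otimes> inv y \<in> H})"
    using finH fin by (simp add: card_as_sums) (rule sum.swap)
  ultimately show ?thesis by simp
qed

lemma (in group) sum_Irr_degree_squares:
  assumes fin: "finite (carrier G)"
  shows "(\<Sum>\<chi>\<in>Irr G. (Re (\<chi> \<one>))\<^sup>2) = real (card (carrier G))"
proof -
  have "(\<Sum>\<chi>\<in>Irr G. (Re (\<chi> \<one>))\<^sup>2) = Re (\<Sum>\<chi>\<in>Irr G. \<chi> (inv \<one>) * \<chi> \<one>)"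
    unfolding Re_sum
  proof (intro sum.cong refl)
    fix \<chi> assume "\<chi> \<in> Irr G"
    then obtain d where "d > 0" "\<chi> \<one> = of_nat d" by (rule Irr_one)
    thus "(Re (\<chi> \<one>))\<^sup>2 = Re (\<chi> (inv \<one>) * \<chi> \<one>)" by (simp add: power2_eq_square)
  qed
  also have "\<dots> = real (card {y \<in> carrier G. y \<otimes> \<one> \<otimes> inv y = \<one>})"
    using column_orthogonality[OF fin one_closed one_closed] by simp
  also have "{y \<in> carrier G. y \<otimes> \<one> \<otimes> inv y = \<one>} = carrier G" by auto
  finally show ?thesis .
qed

text \<open>Column orthogonality is summed over all pairs (h, x) from H. For fixed h, letting x vary
  collects the y that conjugate h into H, and these are counted by the rank formula.\<close>

lemma (in group) sum_Irr_subgroup_squares: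
  assumes fin: "finite (carrier G)" and H: "subgroup H G"
  shows "(\<Sum>\<chi>\<in>Irr G. (\<Sum>h\<in>H. \<chi> h)\<^sup>2) = of_nat (rank_coset G H * card H ^ 2)"
proof -
  have HG: "H \<subseteq> carrier G" using H by (rule subgroup.subset)
  have finH: "finite H" using HG fin by (rule finite_subset)
  \<comment> \<open>One factor of the square is summed over inverses, to match the shape of column
    orthogonality.\<close>
  have inv_sum: "(\<Sum>h\<in>H. \<chi> h) = (\<Sum>h\<in>H. \<chi> (inv h))" for \<chi> :: "'a \<Rightarrow> complex"
    by (rule sum.reindex_bij_witness[of _ "\<lambda>h. inv h" "\<lambda>h. inv h"])
       (use HG subgroup.m_inv_closed[OF H] in auto)
  have "(\<Sum>\<chi>\<in>Irr G. (\<Sum>h\<in>H. \<chi> h)\<^sup>2) = (\<Sum>\<chi>\<in>Irr G. (\<Sum>h\<in>H. \<chi> (inv h)) * (\<Sum>x\<in>H. \<chi> x))"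
    by (intro sum.cong refl) (simp only: power2_eq_square inv_sum[symmetric])
  also have "\<dots> = (\<Sum>\<chi>\<in>Irr G. \<Sum>h\<in>H. \<Sum>x\<in>H. \<chi> (inv h) * \<chi> x)"
    by (simp only: sum_product)
  also have "\<dots> = (\<Sum>h\<in>H. \<Sum>\<chi>\<in>Irr G. \<Sum>x\<in>H. \<chi> (inv h) * \<chi> x)"
    by (rule sum.swap)
  also have "\<dots> = (\<Sum>h\<in>H. \<Sum>x\<in>H. \<Sum>\<chi>\<in>Irr G. \<chi> (inv h) * \<chi> x)"
    by (intro sum.cong refl sum.swap)
  also have "\<dots> = (\<Sum>h\<in>H. \<Sum>x\<in>H. of_nat (card {y \<in> carrier G. y \<otimes> h \<otimes> inv y = x}))"
    using HG by (intro sum.cong refl column_orthogonality[OF fin]) auto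
  also have "\<dots> = (\<Sum>h\<in>H. of_nat (card {y \<in> carrier G. y \<otimes> h \<otimes> inv y \<in> H}))"
  proof (intro sum.cong refl)
    fix h assume "h \<in> H"
    have "card (\<Union>x\<in>H. {y \<in> carrier G. y \<otimes> h \<otimes> inv y = x})
        = (\<Sum>x\<in>H. card {y \<in> carrier G. y \<otimes> h \<otimes> inv y = x})"
      by (rule card_UN_disjoint) (use finH fin in auto)
    moreover have "(\<Union>x\<in>H. {y \<in> carrier G. y \<otimes> h \<otimes> inv y = x})
        = {y \<in> carrier G. y \<otimes> h \<otimes> inv y \<in> H}" by auto
    ultimately show "(\<Sum>x\<in>H. of_nat (card {y \<in> carrier G. y \<otimes> h \<otimes> inv y = x}))
        = (of_nat (card {y \<in> carrier G. y \<otimes> h \<otimes> inv y \<in> H}) :: complex)" by simp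
  qed
  also have "\<dots> = of_nat (rank_coset G H * card H ^ 2)"
    by (simp only: rank_coset_eq[OF fin H] of_nat_sum)
  finally show ?thesis .
qed

lemma (in group) D_H_lower_bound:
  assumes fin: "finite (carrier G)" and H: "subgroup H G"
  shows "D_H G H \<ge> real (rank_coset G H) * real (card H) / (2 * real (card (carrier G)))
    - 1 / (2 * real (card H))"
proof -
  have HG: "H \<subseteq> carrier G" using H by (rule subgroup.subset)
  have finH: "finite H" using HG fin by (rule finite_subset)
  define N where "N = real (card (carrier G))"
  define k where "k = real (card H)"
  have N: "N > 0" using fin by (auto simp: N_def card_gt_0_iff)
  have k: "k > 0" using finH subgroup.one_closed[OF H] by (auto simp: k_def card_gt_0_iff)
  \<comment> \<open>For irreducible \<chi> this sum is the real number k m, so taking the real part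
    loses nothing.\<close>
  define a where "a \<chi> = Re (\<Sum>h\<in>H. \<chi> h)" for \<chi> :: "'a \<Rightarrow> complex"
  have sum_eq: "(\<Sum>h\<in>H. \<chi> h)\<^sup>2 = of_real ((a \<chi>)\<^sup>2)"
    and term_ge: "((a \<chi>)\<^sup>2 - (Re (\<chi> \<one>))\<^sup>2) / (2 * k) \<le> Re (\<chi> \<one>) * cmod (\<Sum>h\<in>H - {\<one>}. \<chi> h)"
    if \<chi>: "\<chi> \<in> Irr G" for \<chi>
  proof -
    obtain m d :: nat where m: "(\<Sum>h\<in>H. \<chi> h) = of_nat (card H) * of_nat m"
      and d: "\<chi> \<one> = of_nat d" and md: "m \<le> d"
      using Irr_subgroup_multiplicity[OF H \<chi>] .
    have a: "a \<chi> = k * m" by (simp add: a_def m k_def)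
    show "(\<Sum>h\<in>H. \<chi> h)\<^sup>2 = of_real ((a \<chi>)\<^sup>2)" by (simp add: m a k_def)
    \<comment> \<open>Dropping the identity from the sum over H subtracts the degree.\<close>
    have "(\<Sum>h\<in>H - {\<one>}. \<chi> h) = of_real (k * m - d)"
      using finH subgroup.one_closed[OF H] by (simp add: sum_diff1 m d k_def)
    hence "cmod (\<Sum>h\<in>H - {\<one>}. \<chi> h) = \<bar>k * m - d\<bar>" by (simp only: norm_of_real)
    moreover have "((k * m)\<^sup>2 - (real d)\<^sup>2) / (2 * k) \<le> d * \<bar>k * m - d\<bar>"
    proof -
      \<comment> \<open>The square is the one for which the mixed term k m d cancels on the left.
        Discarding it is safe because k > 0.\<close>
      have "((k * m)\<^sup>2 - (real d)\<^sup>2) / (2 * k) = m * (k * m - d) - (k * m - d)\<^sup>2 / (2 * k)"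
        using k by (simp add: field_simps power2_eq_square)
      also have "\<dots> \<le> m * (k * m - d)" using k by simp
      also have "\<dots> \<le> m * \<bar>k * m - d\<bar>" by (intro mult_left_mono) auto
      also have "\<dots> \<le> d * \<bar>k * m - d\<bar>" using md by (intro mult_right_mono) auto
      finally show ?thesis .
    qed
    ultimately show "((a \<chi>)\<^sup>2 - (Re (\<chi> \<one>))\<^sup>2) / (2 * k) \<le> Re (\<chi> \<one>) * cmod (\<Sum>h\<in>H - {\<one>}. \<chi> h)"
      by (simp add: a d)
  qed
  have "complex_of_real (\<Sum>\<chi>\<in>Irr G. (a \<chi>)\<^sup>2) = (\<Sum>\<chi>\<in>Irr G. (\<Sum>h\<in>H. \<chi> h)\<^sup>2)"
    by (simp add: sum_eq)
  also have "\<dots> = complex_of_real (rank_coset G H * k\<^sup>2)"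
    by (simp add: sum_Irr_subgroup_squares[OF fin H] k_def)
  finally have sum_a: "(\<Sum>\<chi>\<in>Irr G. (a \<chi>)\<^sup>2) = rank_coset G H * k\<^sup>2" by (simp only: of_real_eq_iff)
  have "rank_coset G H * k / (2 * N) - 1 / (2 * k) = (1 / N) * ((rank_coset G H * k\<^sup>2 - N) / (2 * k))"
    using N k by (simp add: field_simps power2_eq_square)
  also have "(rank_coset G H * k\<^sup>2 - N) / (2 * k)
      = (\<Sum>\<chi>\<in>Irr G. ((a \<chi>)\<^sup>2 - (Re (\<chi> \<one>))\<^sup>2) / (2 * k))"
    by (simp only: sum_a[symmetric] N_def sum_Irr_degree_squares[OF fin, symmetric]
        sum_subtractf[symmetric] sum_divide_distrib)
  also have "(1 / N) * \<dots> \<le> (1 / N) * (\<Sum>\<chi>\<in>Irr G. Re (\<chi> \<one>) * cmod (\<Sum>h\<in>H - {\<one>}. \<chi> h))"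
    using N term_ge by (intro mult_left_mono sum_mono) auto
  finally show ?thesis by (simp add: D_H_def N_def k_def)
qed

section \<open>From the bound for one group to the family\<close>

lemma eventually_in_mono2:
  assumes "eventually_in I P" "eventually_in I Q" "\<And>i. i \<in> I \<Longrightarrow> P i \<Longrightarrow> Q i \<Longrightarrow> R i"
  shows "eventually_in I R"
proof -
  obtain M N where "\<forall>i\<in>I. i \<ge> M \<longrightarrow> P i" "\<forall>i\<in>I. i \<ge> N \<longrightarrow> Q i"
    using assms(1,2) by (auto simp: eventually_in_def)
  thus ?thesis using assms(3) unfolding eventually_in_def by (intro exI[of _ "max M N"]) auto
qed

lemma (in group) rank_coset_pos:
  assumes fin: "finite (carrier G)" and H: "subgroup H G"
  shows "rank_coset G H > 0"
proof -
  have finH: "finite H" using subgroup.subset[OF H] fin by (rule finite_subset)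
  have "\<one> \<in> {y \<in> carrier G. y \<otimes> \<one> \<otimes> inv y \<in> H}" using subgroup.one_closed[OF H] by simp
  hence "card {y \<in> carrier G. y \<otimes> \<one> \<otimes> inv y \<in> H} > 0"
    using fin by (auto simp: card_gt_0_iff)
  hence "(\<Sum>h\<in>H. card {y \<in> carrier G. y \<otimes> h \<otimes> inv y \<in> H}) > 0"
    using finH subgroup.one_closed[OF H] by (intro sum_pos2[of H "\<one>"]) auto
  thus ?thesis by (simp flip: rank_coset_eq[OF fin H])
qed

text \<open>Write x = ln |G| and L = x^c. The main term is at least 1/(2L). One extra power of x
  does two jobs: |H| \<ge> x L makes the loss 1/(2|H|) small against 1/L, and x L in place of 4 L
  absorbs the constant.\<close>

lemma (in group) D_H_ge_inverse_log:
  assumes fin: "finite (carrier G)" and H: "subgroup H G" and c: "c > 0"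
    and subdegree: "real (card (rcosets H)) / real (rank_coset G H) \<le> ln (real (card (carrier G))) powr c"
    and large: "real (card H) \<ge> ln (real (card (carrier G))) powr (c + 1)"
    and ln4: "ln (real (card (carrier G))) \<ge> 4"
  shows "D_H G H \<ge> ln (real (card (carrier G))) powr - (c + 1)"
proof -
  define x where "x = ln (real (card (carrier G)))"
  define N where "N = real (card (carrier G))"
  define k where "k = real (card H)"
  define r where "r = real (rank_coset G H)"
  define L where "L = x powr c"
  have x: "x \<ge> 4" using ln4 by (simp add: x_def)
  have L: "L > 0" using x by (simp add: L_def)
  have r: "r > 0" using rank_coset_pos[OF fin H] by (simp add: r_def)
  have N: "N > 0" using fin by (auto simp: N_def card_gt_0_iff)
  have xL: "x powr (c + 1) = x * L" using x by (simp add: L_def powr_add)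
  have k: "k \<ge> x * L" using large xL by (simp add: k_def x_def)
  have "x * L > 0" using x L by simp
  hence k0: "k > 0" using k by simp
  have "real (card (rcosets H)) * k = N"
    unfolding k_def N_def using lagrange_finite[OF fin H, unfolded Coset.order_def]
    by (simp only: of_nat_mult[symmetric])
  hence "real (card (rcosets H)) = N / k" using k0 by (simp add: eq_divide_eq)
  hence "N / k / r \<le> L" using subdegree unfolding L_def x_def r_def by simp
  hence 1: "1 / L \<le> r * k / N" using L r N k0 by (simp add: field_simps)
  have 2: "1 / k \<le> 1 / (x * L)" using k \<open>x * L > 0\<close> by (intro frac_le) auto
  have "1 / (x * L) \<le> 1 / (4 * L)" using x L by (intro frac_le) auto
  hence 3: "1 / (x * L) \<le> 1 / L / 4" by simp
  have 4: "r * k / N / 2 - 1 / k / 2 \<le> D_H G H"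
    using D_H_lower_bound[OF fin H] by (simp add: r_def k_def N_def mult.commute)
  \<comment> \<open>The quotients are abstracted to u = 1/L, v = r k / N, w = 1/k and z = 1/(x L),
    which leaves a purely linear inequality: v/2 - w/2 \<ge> u/2 - u/8 \<ge> u/4 \<ge> z.\<close>
  have "z \<le> D" if "u \<le> v" "w \<le> z" "z \<le> u / 4" "v / 2 - w / 2 \<le> D" "u > 0" for u v w z D :: real
    using that by linarith
  from this[OF 1 2 3 4] have "1 / (x * L) \<le> D_H G H" using L by simp
  moreover have "x powr - (c + 1) = 1 / (x * L)"
    unfolding powr_minus xL by (rule inverse_eq_divide)
  ultimately have "D_H G H \<ge> x powr - (c + 1)" by (simp only:)
  thus ?thesis by (simp only: x_def)
qed

text \<open>Summing |H| \<le> L |H \<inter> g H inv g| over all g gives |G| |H| \<le> L r |H|^2 by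
  the rank formula. Dividing by |H|^2 r leaves the average subdegree on the left.\<close>

lemma (in group) average_subdegree_le:
  assumes fin: "finite (carrier G)" and H: "subgroup H G"
    and L: "\<And>g. g \<in> carrier G \<Longrightarrow> real (card H) / real (card (H \<inter> ((g <# H) #> inv g))) \<le> L"
  shows "real (card (rcosets H)) / real (rank_coset G H) \<le> L"
proof -
  have finH: "finite H" using subgroup.subset[OF H] fin by (rule finite_subset)
  define N where "N = real (card (carrier G))"
  define k where "k = real (card H)"
  define r where "r = real (rank_coset G H)"
  have k: "k > 0" using finH subgroup.one_closed[OF H] by (auto simp: k_def card_gt_0_iff)
  have r: "r > 0" using rank_coset_pos[OF fin H] by (simp add: r_def)
  have "k \<le> L * real (card (H \<inter> ((g <# H) #> inv g)))" if g: "g \<in> carrier G" for g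
  proof -
    \<comment> \<open>The identity lies in the intersection, so the quotient in the hypothesis has a
      positive denominator and can be cleared; division by zero would yield 0 and carry no
      information.\<close>
    have "g \<otimes> \<one> \<in> g <# H" using subgroup.one_closed[OF H] unfolding l_coset_def by blast
    hence "g \<otimes> \<one> \<otimes> inv g \<in> (g <# H) #> inv g" unfolding r_coset_def by blast
    hence "\<one> \<in> H \<inter> ((g <# H) #> inv g)" using g subgroup.one_closed[OF H] by simp
    hence "card (H \<inter> ((g <# H) #> inv g)) > 0" using finH by (auto simp: card_gt_0_iff)
    thus ?thesis using L[OF g] by (simp add: k_def field_simps)
  qed
  hence "(\<Sum>g\<in>carrier G. k) \<le> (\<Sum>g\<in>carrier G. L * real (card (H \<inter> ((g <# H) #> inv g))))"
    by (rule sum_mono)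
  also have "\<dots> = L * real (rank_coset G H * card H ^ 2)"
    by (simp only: rank_coset_eq[OF fin H] conj_fixed_sum_swap[OF fin H] sum_distrib_left of_nat_sum)
  finally have "N * k \<le> (L * r * k) * k"
    by (simp add: N_def r_def k_def power2_eq_square mult.assoc)
  hence "N \<le> L * r * k" using k by simp
  moreover have "real (card (rcosets H)) * k = N"
    unfolding k_def N_def using lagrange_finite[OF fin H, unfolded Coset.order_def]
    by (simp only: of_nat_mult[symmetric])
  ultimately have "real (card (rcosets H)) * k \<le> L * r * k" by simp
  hence "real (card (rcosets H)) \<le> L * r" using k by simp
  thus ?thesis using r by (simp add: r_def field_simps)
qed

theorem theorem5:
  fixes I :: "nat set" and G :: "nat \<Rightarrow> 'a monoid" and H :: "nat \<Rightarrow> 'a set"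
  assumes I_inf: "infinite I" and I_pos: "\<forall>i\<in>I. i > 0"
    and grp: "\<forall>i\<in>I. group (G i) \<and> finite (carrier (G i)) \<and> subgroup (H i) (G i)"
    and G_large: "\<forall>M::nat. eventually_in I (\<lambda>i. card (carrier (G i)) \<ge> M)"
    and H_superpolylog: "\<forall>c::real>0. eventually_in I
           (\<lambda>i. real (card (H i)) \<ge> ln (real (card (carrier (G i)))) powr c)"
  shows
    "((\<exists>c0::real>0. eventually_in I (\<lambda>i.
         real (card (rcosets\<^bsub>G i\<^esub> (H i))) / real (rank_coset (G i) (H i))
           \<le> ln (real (card (carrier (G i)))) powr c0))
       \<longrightarrow> distinguishable I G H)
     \<and>
     ((\<exists>c0::real>0. eventually_in I (\<lambda>i. \<forall>g\<in>carrier (G i).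
         real (card (H i)) / real (card (H i \<inter> ((g <#\<^bsub>G i\<^esub> H i) #>\<^bsub>G i\<^esub> inv\<^bsub>G i\<^esub> g)))
           \<le> ln (real (card (carrier (G i)))) powr c0))
       \<longrightarrow> distinguishable I G H)"
proof -
  define avg where "avg = (\<lambda>c i. real (card (rcosets\<^bsub>G i\<^esub> (H i))) / real (rank_coset (G i) (H i))
    \<le> ln (real (card (carrier (G i)))) powr c)"
  have A: "distinguishable I G H" if c: "c > 0" and avg: "eventually_in I (avg c)" for c
  proof -
    \<comment> \<open>The growth of |G| is instantiated at the threshold exp 4, rounded up, which
      provides the bound x \<ge> 4.\<close>
    have ln4: "ln (real n) \<ge> 4" if "n \<ge> nat \<lceil>exp 4 :: real\<rceil>" for n
    proof -
      have "exp 4 \<le> real n" using that by linarith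
      hence "ln (exp 4) \<le> ln (real n)" by (intro ln_mono) auto
      thus ?thesis by simp
    qed
    have "eventually_in I (\<lambda>i. ln (real (card (carrier (G i)))) \<ge> 4)"
      by (rule eventually_in_mono2[OF G_large[rule_format] G_large[rule_format], OF ln4])
    \<comment> \<open>The superpolylogarithmic hypothesis is taken one power above c; this is also
      the exponent that witnesses distinguishability.\<close>
    moreover have "eventually_in I (\<lambda>i. real (card (H i)) \<ge> ln (real (card (carrier (G i)))) powr (c + 1))"
      using H_superpolylog c by simp
    ultimately have "eventually_in I (\<lambda>i. ln (real (card (carrier (G i)))) \<ge> 4 \<and>
        real (card (H i)) \<ge> ln (real (card (carrier (G i)))) powr (c + 1))"
      by (rule eventually_in_mono2) simp
    hence "eventually_in I (\<lambda>i. D_H (G i) (H i) \<ge> ln (real (card (carrier (G i)))) powr - (c + 1))"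
    proof (rule eventually_in_mono2[OF avg])
      fix i assume "i \<in> I" "avg c i" and *: "4 \<le> ln (real (card (carrier (G i)))) \<and>
        ln (real (card (carrier (G i)))) powr (c + 1) \<le> real (card (H i))"
      hence G: "group (G i)" "finite (carrier (G i))" "subgroup (H i) (G i)" using grp by auto
      show "ln (real (card (carrier (G i)))) powr - (c + 1) \<le> D_H (G i) (H i)"
        using group.D_H_ge_inverse_log[OF G c] \<open>avg c i\<close> * by (simp add: avg_def)
    qed
    thus ?thesis using c unfolding distinguishable_def by (intro exI[of _ "c + 1"]) simp
  qed
  have B: "distinguishable I G H" if c: "c > 0"
    and ev: "eventually_in I (\<lambda>i. \<forall>g\<in>carrier (G i).
         real (card (H i)) / real (card (H i \<inter> ((g <#\<^bsub>G i\<^esub> H i) #>\<^bsub>G i\<^esub> inv\<^bsub>G i\<^esub> g)))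
           \<le> ln (real (card (carrier (G i)))) powr c)" for c
  \<comment> \<open>A bound on every subdegree bounds their average, so the first claim applies with
    the same exponent.\<close>
  proof (rule A[OF c])
    show "eventually_in I (avg c)"
    proof (rule eventually_in_mono2[OF ev ev])
      fix i assume "i \<in> I" and sub: "\<forall>g\<in>carrier (G i).
         real (card (H i)) / real (card (H i \<inter> ((g <#\<^bsub>G i\<^esub> H i) #>\<^bsub>G i\<^esub> inv\<^bsub>G i\<^esub> g)))
           \<le> ln (real (card (carrier (G i)))) powr c"
      hence G: "group (G i)" "finite (carrier (G i))" "subgroup (H i) (G i)" using grp by auto
      show "avg c i" unfolding avg_def
        by (rule group.average_subdegree_le[OF G]) (rule bspec[OF sub])
    qed
  qed
  show ?thesis using A[unfolded avg_def] B by blast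
qed

end
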